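(* Let $\mathsf F$ be a noetherian form on a category $\mathcal D$, with induced proper factorization system $(\mathcal E,\mathcal M)$, and let $\mathcal C$ be a full, replete subcategory of $\mathcal D$. Suppose that (i) if $m:A\to X$ belongs to $\mathcal M$ and $X$ belongs to $\mathcal C$, then $A$ belongs to $\mathcal C$; (ii) if $e:X\to B$ belongs to $\mathcal E$ and $X$ belongs to $\mathcal C$, then $B$ belongs to $\mathcal C$. Then the restrictions of $\mathcal E$ and $\mathcal M$ to $\mathcal C$ form a proper factorization system, the inclusion $J:\mathcal C\hookrightarrow\mathcal D$ is a transfer functor, and $J^*\mathsf F$ (the form with fibres $\mathsf F(JX)$ and transports those of $\mathsf F$ along $Jf$) is a noetherian form inducing that system. If the fibres of $\mathsf F$ are complete, algebraic, or modular, the restricted form has the corresponding properties.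
   Context: Conventions: categories are locally small; "set" is relative to a fixed universe. A conservative functor is one that reflects isomorphisms. A proper factorization system $(\mathcal E,\mathcal M)$ is an orthogonal factorization system with every morphism in $\mathcal E$ an epimorphism and every morphism in $\mathcal M$ a monomorphism. A complete lattice is algebraic when each element is a join of compact elements. Transfer functors. Let $\mathcal C,\mathcal D$ have specified proper factorization systems $(\mathcal E_{\mathcal C},\mathcal M_{\mathcal C})$, $(\mathcal E_{\mathcal D},\mathcal M_{\mathcal D})$, and suppose both have pullbacks of two right-class morphisms with common codomain and pushouts of two left-class morphisms with common domain (existence of these diagrams is part of what is asserted when a functor is called a transfer functor). A transfer functor $T:\mathcal C\to\mathcal D$ is a conservative functor with $T(\mathcal E_{\mathcal C})\subseteq\mathcal E_{\mathcal D}$, $T(\mathcal M_{\mathcal C})\subseteq\mathcal M_{\mathcal D}$, preserving pullbacks of two $\mathcal M_{\mathcal C}$-morphisms and pushouts of two $\mathcal E_{\mathcal C}$-morphisms. Forms. An (orean) form $\mathsf F$ on a category $\mathcal C$ assigns to each object $X$ a set-sized bounded lattice $\mathsf F(X)$ (the fibre over $X$; its elements are called clusters) and to each morphism $f:X\to Y$ monotone maps $f_!:\mathsf F(X)\to\mathsf F(Y)$ and $f^*:\mathsf F(Y)\to\mathsf F(X)$ with $f_!S\le T\iff S\le f^*T$, such that $(gf)_!=g_!f_!$, $(gf)^*=f^*g^*$, and identities act as identities. Put $\operatorname{Im}f=f_!\top_X$ and $\operatorname{Ker}f=f^*\bot_Y$. A cluster in $\mathsf F(X)$ is conormal if it is the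 image of some morphism of $\mathcal C$ with codomain $X$, and normal if it is the kernel of some morphism of $\mathcal C$ with domain $X$. An embedding of a conormal $S\in\mathsf F(X)$ is a morphism $\iota$ into $X$ with $\operatorname{Im}\iota=S$ such that every morphism $f$ into $X$ with $\operatorname{Im}f\le S$ factors as $f=\iota h$ for a unique $h$. A quotient of a normal $K\in\mathsf F(X)$ is a morphism $\pi$ out of $X$ with $\operatorname{Ker}\pi=K$ such that every morphism $g$ out of $X$ with $K\le\operatorname{Ker}g$ factors as $g=h\pi$ for a unique $h$. The form is noetherian if: (N1) $f^*f_!S=S\vee\operatorname{Ker}f$ and $f_!f^*T=T\wedge\operatorname{Im}f$ for all $f,S,T$; (N2) every morphism $f$ factors as $f=me$ with $e$ a quotient of $\operatorname{Ker}f$ and $m$ an embedding of $\operatorname{Im}f$; (N3) the join of two normal clusters (in the same fibre) is normal, and the meet of two conormal clusters is conormal. For a noetherian form, the class $\mathcal E$ of all quotients (of normal clusters) and the class $\mathcal M$ of all embeddings (of conormal clusters) form a proper factorization system, the one induced by the form. *)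

theory Defs
  imports "HOL-Algebra.Galois_Connection"
begin

section \<open>Categories and functors\<close>

text \<open>
  A category is a record whose objects and morphisms form sets; nothing is required of the
  operations outside these sets.  Composition is written in the order of function
  application: \<open>g \<cdot> f\<close> means first \<open>f\<close>, then \<open>g\<close>.
\<close>

record ('o, 'a) category =
  Obj :: "'o set"
  Arr :: "'a set"
  Dom :: "'a \<Rightarrow> 'o"
  Cod :: "'a \<Rightarrow> 'o"
  Id :: "'o \<Rightarrow> 'a"
  Comp :: "'a \<Rightarrow> 'a \<Rightarrow> 'a"  (infixr \<open>\<cdot>\<index>\<close> 75)

definition Hom :: "('o, 'a) category \<Rightarrow> 'o \<Rightarrow> 'o \<Rightarrow> 'a set" where
  "Hom C X Y = {f \<in> Arr C. Dom C f = X \<and> Cod C f = Y}"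

locale category =
  fixes C :: "('o, 'a) category" (structure)
  assumes Dom_Obj: "f \<in> Arr C \<Longrightarrow> Dom C f \<in> Obj C"
    and Cod_Obj: "f \<in> Arr C \<Longrightarrow> Cod C f \<in> Obj C"
    and Id_Hom: "X \<in> Obj C \<Longrightarrow> Id C X \<in> Hom C X X"
    and Comp_Hom: "\<lbrakk>f \<in> Hom C X Y; g \<in> Hom C Y Z\<rbrakk> \<Longrightarrow> g \<cdot> f \<in> Hom C X Z"
    and Comp_Id: "f \<in> Hom C X Y \<Longrightarrow> f \<cdot> Id C X = f"
    and Id_Comp: "f \<in> Hom C X Y \<Longrightarrow> Id C Y \<cdot> f = f"
    and Comp_assoc: "\<lbrakk>f \<in> Hom C W X; g \<in> Hom C X Y; h \<in> Hom C Y Z\<rbrakk>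
      \<Longrightarrow> (h \<cdot> g) \<cdot> f = h \<cdot> (g \<cdot> f)"

definition mono_arr :: "('o, 'a) category \<Rightarrow> 'a \<Rightarrow> bool" where
  "mono_arr C m \<longleftrightarrow> m \<in> Arr C \<and>
     (\<forall>W. \<forall>u \<in> Hom C W (Dom C m). \<forall>v \<in> Hom C W (Dom C m).
        m \<cdot>\<^bsub>C\<^esub> u = m \<cdot>\<^bsub>C\<^esub> v \<longrightarrow> u = v)"

definition epi_arr :: "('o, 'a) category \<Rightarrow> 'a \<Rightarrow> bool" where
  "epi_arr C e \<longleftrightarrow> e \<in> Arr C \<and>
     (\<forall>Z. \<forall>u \<in> Hom C (Cod C e) Z. \<forall>v \<in> Hom C (Cod C e) Z.
        u \<cdot>\<^bsub>C\<^esub> e = v \<cdot>\<^bsub>C\<^esub> e \<longrightarrow> u = v)"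

definition iso_arr :: "('o, 'a) category \<Rightarrow> 'a \<Rightarrow> bool" where
  "iso_arr C f \<longleftrightarrow> f \<in> Arr C \<and>
     (\<exists>g \<in> Hom C (Cod C f) (Dom C f).
        g \<cdot>\<^bsub>C\<^esub> f = Id C (Dom C f) \<and> f \<cdot>\<^bsub>C\<^esub> g = Id C (Cod C f))"

definition is_pullback ::
    "('o, 'a) category \<Rightarrow> 'a \<Rightarrow> 'a \<Rightarrow> 'a \<Rightarrow> 'a \<Rightarrow> bool" where
  \<comment> \<open>\<open>p\<close>, \<open>q\<close> are the projections: \<open>f \<cdot> p = g \<cdot> q\<close>\<close>
  "is_pullback C f g p q \<longleftrightarrow>
     f \<in> Arr C \<and> g \<in> Arr C \<and> Cod C f = Cod C g \<and>
     p \<in> Hom C (Dom C p) (Dom C f) \<and> q \<in> Hom C (Dom C p) (Dom C g) \<and>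
     f \<cdot>\<^bsub>C\<^esub> p = g \<cdot>\<^bsub>C\<^esub> q \<and>
     (\<forall>W. \<forall>u \<in> Hom C W (Dom C f). \<forall>v \<in> Hom C W (Dom C g).
        f \<cdot>\<^bsub>C\<^esub> u = g \<cdot>\<^bsub>C\<^esub> v \<longrightarrow>
        (\<exists>!h. h \<in> Hom C W (Dom C p) \<and> p \<cdot>\<^bsub>C\<^esub> h = u \<and> q \<cdot>\<^bsub>C\<^esub> h = v))"

definition is_pushout ::
    "('o, 'a) category \<Rightarrow> 'a \<Rightarrow> 'a \<Rightarrow> 'a \<Rightarrow> 'a \<Rightarrow> bool" where
  \<comment> \<open>\<open>p\<close>, \<open>q\<close> are the coprojections: \<open>p \<cdot> f = q \<cdot> g\<close>\<close>
  "is_pushout C f g p q \<longleftrightarrow>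
     f \<in> Arr C \<and> g \<in> Arr C \<and> Dom C f = Dom C g \<and>
     p \<in> Hom C (Cod C f) (Cod C p) \<and> q \<in> Hom C (Cod C g) (Cod C p) \<and>
     p \<cdot>\<^bsub>C\<^esub> f = q \<cdot>\<^bsub>C\<^esub> g \<and>
     (\<forall>Z. \<forall>u \<in> Hom C (Cod C f) Z. \<forall>v \<in> Hom C (Cod C g) Z.
        u \<cdot>\<^bsub>C\<^esub> f = v \<cdot>\<^bsub>C\<^esub> g \<longrightarrow>
        (\<exists>!h. h \<in> Hom C (Cod C p) Z \<and> h \<cdot>\<^bsub>C\<^esub> p = u \<and> h \<cdot>\<^bsub>C\<^esub> q = v))"

record ('o1, 'a1, 'o2, 'a2) cat_map =
  on_Obj :: "'o1 \<Rightarrow> 'o2"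
  on_Arr :: "'a1 \<Rightarrow> 'a2"

locale cat_functor = source: category C + target: category D
  for C :: "('o1, 'a1) category" and D :: "('o2, 'a2) category" +
  fixes T :: "('o1, 'a1, 'o2, 'a2) cat_map"
  assumes on_Obj: "X \<in> Obj C \<Longrightarrow> on_Obj T X \<in> Obj D"
    and on_Arr: "f \<in> Hom C X Y \<Longrightarrow> on_Arr T f \<in> Hom D (on_Obj T X) (on_Obj T Y)"
    and on_Id: "X \<in> Obj C \<Longrightarrow> on_Arr T (Id C X) = Id D (on_Obj T X)"
    and on_Comp: "\<lbrakk>f \<in> Hom C X Y; g \<in> Hom C Y Z\<rbrakk>
      \<Longrightarrow> on_Arr T (g \<cdot>\<^bsub>C\<^esub> f) = on_Arr T g \<cdot>\<^bsub>D\<^esub> on_Arr T f"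

locale subcategory = sub: category C + ambient: category D
  for C :: "('o, 'a) category" and D :: "('o, 'a) category" +
  assumes Obj_subset: "Obj C \<subseteq> Obj D"
    and Arr_subset: "Arr C \<subseteq> Arr D"
    and Dom_eq: "f \<in> Arr C \<Longrightarrow> Dom C f = Dom D f"
    and Cod_eq: "f \<in> Arr C \<Longrightarrow> Cod C f = Cod D f"
    and Id_eq: "X \<in> Obj C \<Longrightarrow> Id C X = Id D X"
    and Comp_eq: "\<lbrakk>f \<in> Hom C X Y; g \<in> Hom C Y Z\<rbrakk> \<Longrightarrow> g \<cdot>\<^bsub>C\<^esub> f = g \<cdot>\<^bsub>D\<^esub> f"

locale full_replete_subcategory = subcategory +
  assumes full: "\<lbrakk>X \<in> Obj C; Y \<in> Obj C\<rbrakk> \<Longrightarrow> Hom C X Y = Hom D X Y"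
    and replete: "\<lbrakk>iso_arr D f; Dom D f \<in> Obj C\<rbrakk> \<Longrightarrow> f \<in> Arr C"

text \<open>
  The inclusion of a subcategory is the identity on the underlying types; its source and
  target are supplied where it is used as a functor.
\<close>

definition inclusion :: "('o, 'a, 'o, 'a) cat_map" where
  "inclusion = \<lparr>on_Obj = (\<lambda>X. X), on_Arr = (\<lambda>f. f)\<rparr>"


section \<open>Proper factorization systems and transfer functors\<close>

locale proper_factorization_system = category C
  for C :: "('o, 'a) category" (structure) +
  fixes E M :: "'a set"
  assumes left_epi: "e \<in> E \<Longrightarrow> epi_arr C e"
    and right_mono: "m \<in> M \<Longrightarrow> mono_arr C m"
    and iso_left: "iso_arr C f \<Longrightarrow> f \<in> E"
    and iso_right: "iso_arr C f \<Longrightarrow> f \<in> M"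
    and left_comp: "\<lbrakk>e \<in> E; e' \<in> E; Cod C e = Dom C e'\<rbrakk> \<Longrightarrow> e' \<cdot> e \<in> E"
    and right_comp: "\<lbrakk>m \<in> M; m' \<in> M; Cod C m = Dom C m'\<rbrakk> \<Longrightarrow> m' \<cdot> m \<in> M"
    and factorization: "f \<in> Arr C \<Longrightarrow>
      \<exists>e \<in> E. \<exists>m \<in> M. Dom C m = Cod C e \<and> f = m \<cdot> e"
    and orthogonal: "\<lbrakk>e \<in> E; m \<in> M; u \<in> Hom C (Dom C e) (Dom C m);
        v \<in> Hom C (Cod C e) (Cod C m); m \<cdot> u = v \<cdot> e\<rbrakk>
      \<Longrightarrow> \<exists>!d. d \<in> Hom C (Cod C e) (Dom C m) \<and> d \<cdot> e = u \<and> m \<cdot> d = v"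

definition has_pullbacks_of :: "('o, 'a) category \<Rightarrow> 'a set \<Rightarrow> bool" where
  "has_pullbacks_of C M \<longleftrightarrow>
     (\<forall>m \<in> M. \<forall>n \<in> M. Cod C m = Cod C n \<longrightarrow> (\<exists>p q. is_pullback C m n p q))"

definition has_pushouts_of :: "('o, 'a) category \<Rightarrow> 'a set \<Rightarrow> bool" where
  "has_pushouts_of C E \<longleftrightarrow>
     (\<forall>d \<in> E. \<forall>e \<in> E. Dom C d = Dom C e \<longrightarrow> (\<exists>p q. is_pushout C d e p q))"

locale transfer_functor = cat_functor C D T +
    source: proper_factorization_system C E\<^sub>C M\<^sub>C +
    target: proper_factorization_system D E\<^sub>D M\<^sub>D
  for C :: "('o1, 'a1) category" and E\<^sub>C M\<^sub>C :: "'a1 set"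
    and D :: "('o2, 'a2) category" and E\<^sub>D M\<^sub>D :: "'a2 set"
    and T :: "('o1, 'a1, 'o2, 'a2) cat_map" +
  assumes source_pullbacks: "has_pullbacks_of C M\<^sub>C"
    and source_pushouts: "has_pushouts_of C E\<^sub>C"
    and target_pullbacks: "has_pullbacks_of D M\<^sub>D"
    and target_pushouts: "has_pushouts_of D E\<^sub>D"
    and conservative: "\<lbrakk>f \<in> Arr C; iso_arr D (on_Arr T f)\<rbrakk> \<Longrightarrow> iso_arr C f"
    and left_class: "e \<in> E\<^sub>C \<Longrightarrow> on_Arr T e \<in> E\<^sub>D"
    and right_class: "m \<in> M\<^sub>C \<Longrightarrow> on_Arr T m \<in> M\<^sub>D"
    and preserves_pullbacks: "\<lbrakk>m \<in> M\<^sub>C; n \<in> M\<^sub>C; is_pullback C m n p q\<rbrakk>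
      \<Longrightarrow> is_pullback D (on_Arr T m) (on_Arr T n) (on_Arr T p) (on_Arr T q)"
    and preserves_pushouts: "\<lbrakk>d \<in> E\<^sub>C; e \<in> E\<^sub>C; is_pushout C d e p q\<rbrakk>
      \<Longrightarrow> is_pushout D (on_Arr T d) (on_Arr T e) (on_Arr T p) (on_Arr T q)"


section \<open>Forms\<close>

text \<open>
  The transports along \<open>f\<close> are \<open>push F f\<close> (direct image, \<open>f\<^sub>!\<close>) and
  \<open>pull F f\<close> (inverse image, \<open>f\<^sup>*\<close>).  All fibres are subsets of one common type of clusters.
\<close>

record ('o, 'a, 'c) form =
  fibre :: "'o \<Rightarrow> 'c gorder"
  push :: "'a \<Rightarrow> 'c \<Rightarrow> 'c"
  pull :: "'a \<Rightarrow> 'c \<Rightarrow> 'c"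

text \<open>
  Monotonicity of the transports is part of the Galois connection: see
  \<open>galois_connection.lower_iso\<close> and \<open>galois_connection.upper_iso\<close>.
\<close>

locale orean_form = category C
  for C :: "('o, 'a) category" (structure) +
  fixes F :: "('o, 'a, 'c) form"
  assumes fibre_lattice: "X \<in> Obj C \<Longrightarrow> bounded_lattice (fibre F X)"
    and transport: "f \<in> Hom C X Y \<Longrightarrow>
      galois_connection \<lparr>orderA = fibre F X, orderB = fibre F Y, lower = push F f, upper = pull F f\<rparr>"
    and push_Comp: "\<lbrakk>f \<in> Hom C X Y; g \<in> Hom C Y Z; S \<in> carrier (fibre F X)\<rbrakk>
      \<Longrightarrow> push F (g \<cdot> f) S = push F g (push F f S)"
    and pull_Comp: "\<lbrakk>f \<in> Hom C X Y; g \<in> Hom C Y Z; U \<in> carrier (fibre F Z)\<rbrakk>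
      \<Longrightarrow> pull F (g \<cdot> f) U = pull F f (pull F g U)"
    and push_Id: "\<lbrakk>X \<in> Obj C; S \<in> carrier (fibre F X)\<rbrakk> \<Longrightarrow> push F (Id C X) S = S"
    and pull_Id: "\<lbrakk>X \<in> Obj C; S \<in> carrier (fibre F X)\<rbrakk> \<Longrightarrow> pull F (Id C X) S = S"

definition Im :: "('o, 'a) category \<Rightarrow> ('o, 'a, 'c) form \<Rightarrow> 'a \<Rightarrow> 'c" where
  "Im C F f = push F f \<top>\<^bsub>fibre F (Dom C f)\<^esub>"

definition Ker :: "('o, 'a) category \<Rightarrow> ('o, 'a, 'c) form \<Rightarrow> 'a \<Rightarrow> 'c" where
  "Ker C F f = pull F f \<bottom>\<^bsub>fibre F (Cod C f)\<^esub>"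

definition conormal :: "('o, 'a) category \<Rightarrow> ('o, 'a, 'c) form \<Rightarrow> 'o \<Rightarrow> 'c \<Rightarrow> bool" where
  "conormal C F X S \<longleftrightarrow> (\<exists>f \<in> Arr C. Cod C f = X \<and> Im C F f = S)"

definition normal :: "('o, 'a) category \<Rightarrow> ('o, 'a, 'c) form \<Rightarrow> 'o \<Rightarrow> 'c \<Rightarrow> bool" where
  "normal C F X K \<longleftrightarrow> (\<exists>f \<in> Arr C. Dom C f = X \<and> Ker C F f = K)"

definition embedding_of ::
    "('o, 'a) category \<Rightarrow> ('o, 'a, 'c) form \<Rightarrow> 'o \<Rightarrow> 'c \<Rightarrow> 'a \<Rightarrow> bool" where
  "embedding_of C F X S i \<longleftrightarrow>
     conormal C F X S \<and> i \<in> Arr C \<and> Cod C i = X \<and> Im C F i = S \<and>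
     (\<forall>f \<in> Arr C. Cod C f = X \<and> Im C F f \<sqsubseteq>\<^bsub>fibre F X\<^esub> S \<longrightarrow>
        (\<exists>!h. h \<in> Hom C (Dom C f) (Dom C i) \<and> f = i \<cdot>\<^bsub>C\<^esub> h))"

definition quotient_of ::
    "('o, 'a) category \<Rightarrow> ('o, 'a, 'c) form \<Rightarrow> 'o \<Rightarrow> 'c \<Rightarrow> 'a \<Rightarrow> bool" where
  "quotient_of C F X K p \<longleftrightarrow>
     normal C F X K \<and> p \<in> Arr C \<and> Dom C p = X \<and> Ker C F p = K \<and>
     (\<forall>g \<in> Arr C. Dom C g = X \<and> K \<sqsubseteq>\<^bsub>fibre F X\<^esub> Ker C F g \<longrightarrow>
        (\<exists>!h. h \<in> Hom C (Cod C p) (Cod C g) \<and> g = h \<cdot>\<^bsub>C\<^esub> p))"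

definition embeddings :: "('o, 'a) category \<Rightarrow> ('o, 'a, 'c) form \<Rightarrow> 'a set" where
  "embeddings C F = {i. \<exists>X S. embedding_of C F X S i}"

definition quotients :: "('o, 'a) category \<Rightarrow> ('o, 'a, 'c) form \<Rightarrow> 'a set" where
  "quotients C F = {p. \<exists>X K. quotient_of C F X K p}"

locale noetherian_form = orean_form C F
  for C :: "('o, 'a) category" (structure) and F :: "('o, 'a, 'c) form" +
  assumes pull_push: "\<lbrakk>f \<in> Hom C X Y; S \<in> carrier (fibre F X)\<rbrakk>
      \<Longrightarrow> pull F f (push F f S) = S \<squnion>\<^bsub>fibre F X\<^esub> Ker C F f"
    and push_pull: "\<lbrakk>f \<in> Hom C X Y; U \<in> carrier (fibre F Y)\<rbrakk>
      \<Longrightarrow> push F f (pull F f U) = U \<sqinter>\<^bsub>fibre F Y\<^esub> Im C F f"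
    and form_factorization: "f \<in> Hom C X Y \<Longrightarrow>
      \<exists>e m. quotient_of C F X (Ker C F f) e \<and> embedding_of C F Y (Im C F f) m \<and>
        Dom C m = Cod C e \<and> f = m \<cdot> e"
    and normal_join: "\<lbrakk>X \<in> Obj C; normal C F X K; normal C F X L\<rbrakk>
      \<Longrightarrow> normal C F X (K \<squnion>\<^bsub>fibre F X\<^esub> L)"
    and conormal_meet: "\<lbrakk>X \<in> Obj C; conormal C F X S; conormal C F X R\<rbrakk>
      \<Longrightarrow> conormal C F X (S \<sqinter>\<^bsub>fibre F X\<^esub> R)"

text \<open>
  That the two classes induced by a noetherian form are a proper factorization system is a
  theorem, so it is not part of the following definition.
\<close>

definition induces_system ::
    "('o, 'a) category \<Rightarrow> ('o, 'a, 'c) form \<Rightarrow> 'a set \<Rightarrow> 'a set \<Rightarrow> bool" where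
  "induces_system C F E M \<longleftrightarrow> E = quotients C F \<and> M = embeddings C F"

definition pullback_form ::
    "('o1, 'a1, 'o2, 'a2) cat_map \<Rightarrow> ('o2, 'a2, 'c) form \<Rightarrow> ('o1, 'a1, 'c) form" where
  "pullback_form T F =
     \<lparr>fibre = (\<lambda>X. fibre F (on_Obj T X)),
      push = (\<lambda>f. push F (on_Arr T f)),
      pull = (\<lambda>f. pull F (on_Arr T f))\<rparr>"


section \<open>Algebraic and modular lattices\<close>

definition compact_element :: "('c, 'm) gorder_scheme \<Rightarrow> 'c \<Rightarrow> bool" where
  "compact_element L c \<longleftrightarrow> c \<in> carrier L \<and>
     (\<forall>A \<subseteq> carrier L. c \<sqsubseteq>\<^bsub>L\<^esub> \<Squnion>\<^bsub>L\<^esub> A \<longrightarrow> (\<exists>B \<subseteq> A. finite B \<and> c \<sqsubseteq>\<^bsub>L\<^esub> \<Squnion>\<^bsub>L\<^esub> B))"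

locale algebraic_lattice = complete_lattice +
  assumes join_of_compact: "x \<in> carrier L \<Longrightarrow>
    \<exists>A \<subseteq> {c. compact_element L c}. x = \<Squnion> A"

locale modular_lattice = lattice +
  assumes modular_law: "\<lbrakk>x \<in> carrier L; y \<in> carrier L; z \<in> carrier L; x \<sqsubseteq> z\<rbrakk>
    \<Longrightarrow> x \<squnion> (y \<sqinter> z) = (x \<squnion> y) \<sqinter> z"

definition complete_fibres :: "('o, 'a) category \<Rightarrow> ('o, 'a, 'c) form \<Rightarrow> bool" where
  "complete_fibres C F \<longleftrightarrow> (\<forall>X \<in> Obj C. complete_lattice (fibre F X))"

definition algebraic_fibres :: "('o, 'a) category \<Rightarrow> ('o, 'a, 'c) form \<Rightarrow> bool" where
  "algebraic_fibres C F \<longleftrightarrow> (\<forall>X \<in> Obj C. algebraic_lattice (fibre F X))"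

definition modular_fibres :: "('o, 'a) category \<Rightarrow> ('o, 'a, 'c) form \<Rightarrow> bool" where
  "modular_fibres C F \<longleftrightarrow> (\<forall>X \<in> Obj C. modular_lattice (fibre F X))"

end

theory Submission
  imports Defs
begin

text \<open>
  The essential point is that the pullback of two embeddings in the ambient category is an
  embedding of the meet of their images, so its apex lies in any subcategory closed under
  embeddings.  Such a full subcategory therefore has the same pullbacks of embeddings, the same
  image factorizations and the same conormal clusters as the ambient category.  An embedding in
  the subcategory is isomorphic to the ambient embedding of the same cluster, so the induced
  classes restrict as well.  Everything about quotients follows by passing to the opposite
  category and the opposite fibres, under which a noetherian form remains noetherian.
\<close>

section \<open>Duality\<close>

text \<open>Passing from \<open>D\<close> to \<open>C\<close> is the easy direction: a universal
  property of \<open>D\<close> survives in \<open>C\<close> by fullness once the representing object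
  lies in \<open>C\<close>. The converse is the obstacle. A pullback or an embedding of
  \<open>C\<close> is tested only against objects of \<open>C\<close>, while preservation by the
  inclusion and equality of the induced classes demand test objects from all of \<open>D\<close>.
  The way out in both cases is an ambient solution of the same problem that happens to lie in
  \<open>C\<close>; the given solution is then compared with it. Inside \<open>D\<close>, the
  workhorse is that an embedding has kernel \<bottom>. With (N1) this makes direct image along an
  embedding order-reflecting, which gives closure under composition, and it also yields
  orthogonality against quotients.\<close>

definition op_cat :: "('o, 'a) category \<Rightarrow> ('o, 'a) category" where
  "op_cat C = \<lparr>Obj = Obj C, Arr = Arr C, Dom = Cod C, Cod = Dom C, Id = Id C,
     Comp = (\<lambda>g f. f \<cdot>\<^bsub>C\<^esub> g)\<rparr>"

text \<open>Reversing every fibre turns the right adjoint into the left one, so inverse image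
  becomes direct image and \<bottom> becomes \<top>; hence kernels and images are exchanged.\<close>

definition op_form :: "('o, 'a, 'c) form \<Rightarrow> ('o, 'a, 'c) form" where
  "op_form F = \<lparr>fibre = (\<lambda>X. inv_gorder (fibre F X)), push = pull F, pull = push F\<rparr>"

lemma op_cat_simps [simp]:
  "Obj (op_cat C) = Obj C" "Arr (op_cat C) = Arr C" "Dom (op_cat C) = Cod C"
  "Cod (op_cat C) = Dom C" "Id (op_cat C) = Id C" "g \<cdot>\<^bsub>op_cat C\<^esub> f = f \<cdot>\<^bsub>C\<^esub> g"
  by (simp_all add: op_cat_def)

lemma Hom_op_cat [simp]: "Hom (op_cat C) X Y = Hom C Y X"
  by (auto simp: Hom_def)

lemma op_form_simps [simp]:
  "fibre (op_form F) X = inv_gorder (fibre F X)" "push (op_form F) = pull F"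
  "pull (op_form F) = push F"
  by (simp_all add: op_form_def)

lemma mono_arr_op_cat [simp]: "mono_arr (op_cat C) f \<longleftrightarrow> epi_arr C f"
  by (simp add: mono_arr_def epi_arr_def)

lemma iso_arr_op_cat [simp]: "iso_arr (op_cat C) f \<longleftrightarrow> iso_arr C f"
  by (auto simp: iso_arr_def)

lemma is_pullback_op_cat [simp]: "is_pullback (op_cat C) f g p q \<longleftrightarrow> is_pushout C f g p q"
  by (simp add: is_pullback_def is_pushout_def)

lemma has_pullbacks_of_op_cat [simp]: "has_pullbacks_of (op_cat C) S \<longleftrightarrow> has_pushouts_of C S"
  by (simp add: has_pullbacks_of_def has_pushouts_of_def)

lemma Im_op [simp]: "Im (op_cat C) (op_form F) f = Ker C F f"
  by (simp add: Im_def Ker_def)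

lemma Ker_op [simp]: "Ker (op_cat C) (op_form F) f = Im C F f"
  by (simp add: Im_def Ker_def)

lemma conormal_op [simp]: "conormal (op_cat C) (op_form F) X S \<longleftrightarrow> normal C F X S"
  by (simp add: conormal_def normal_def)

lemma normal_op [simp]: "normal (op_cat C) (op_form F) X S \<longleftrightarrow> conormal C F X S"
  by (simp add: conormal_def normal_def)

lemma embedding_of_op [simp]:
  "embedding_of (op_cat C) (op_form F) X S i \<longleftrightarrow> quotient_of C F X S i"
  by (simp add: embedding_of_def quotient_of_def)

lemma quotient_of_op [simp]:
  "quotient_of (op_cat C) (op_form F) X S i \<longleftrightarrow> embedding_of C F X S i"
  by (simp add: embedding_of_def quotient_of_def)

lemma embeddings_op [simp]: "embeddings (op_cat C) (op_form F) = quotients C F"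
  by (simp add: embeddings_def quotients_def)

lemma quotients_op [simp]: "quotients (op_cat C) (op_form F) = embeddings C F"
  by (simp add: embeddings_def quotients_def)

lemma (in category) category_op: "category (op_cat C)"
  by unfold_locales (auto simp: Dom_Obj Cod_Obj Id_Hom Comp_Id Id_Comp Comp_assoc intro: Comp_Hom)

lemma (in bounded_lattice) bounded_lattice_dual: "bounded_lattice (inv_gorder L)"
proof -
  interpret dual: lattice "inv_gorder L"
    by (rule dual_lattice)
  show ?thesis
    by unfold_locales (use bottom_exists top_exists in auto)
qed

lemma (in orean_form) orean_form_op: "orean_form (op_cat C) (op_form F)"
  by (intro orean_form.intro orean_form_axioms.intro category_op)
    (auto simp: push_Comp pull_Comp push_Id pull_Id
      intro: bounded_lattice.bounded_lattice_dual fibre_lattice transport)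

text \<open>The two equations of (N1) change places, as do the two clauses of (N3), and in (N2) the
  two factors swap roles.\<close>

lemma (in noetherian_form) noetherian_form_op: "noetherian_form (op_cat C) (op_form F)"
proof -
  interpret op: orean_form "op_cat C" "op_form F"
    by (rule orean_form_op)
  show ?thesis
  proof
    fix f X Y
    assume "f \<in> Hom (op_cat C) X Y"
    then obtain e m where "quotient_of C F Y (Ker C F f) e" "embedding_of C F X (Im C F f) m"
      "Dom C m = Cod C e" "f = m \<cdot> e"
      using form_factorization by force
    then show "\<exists>e m. quotient_of (op_cat C) (op_form F) X (Ker (op_cat C) (op_form F) f) e \<and>
        embedding_of (op_cat C) (op_form F) Y (Im (op_cat C) (op_form F) f) m \<and>
        Dom (op_cat C) m = Cod (op_cat C) e \<and> f = m \<cdot>\<^bsub>op_cat C\<^esub> e"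
      by (intro exI[of _ m] exI[of _ e]) simp
  qed (auto simp: push_pull pull_push conormal_meet normal_join)
qed


section \<open>The factorization system induced by a noetherian form\<close>

context category
begin

lemma arr_in_Hom: "f \<in> Arr C \<Longrightarrow> f \<in> Hom C (Dom C f) (Cod C f)"
  by (simp add: Hom_def)

lemma mono_arrI:
  assumes "m \<in> Hom C X Y"
    and "\<And>W u v. \<lbrakk>u \<in> Hom C W X; v \<in> Hom C W X; m \<cdot> u = m \<cdot> v\<rbrakk> \<Longrightarrow> u = v"
  shows "mono_arr C m"
  using assms unfolding mono_arr_def Hom_def by blast

lemma mono_arrD:
  "\<lbrakk>mono_arr C m; m \<in> Hom C X Y; u \<in> Hom C W X; v \<in> Hom C W X; m \<cdot> u = m \<cdot> v\<rbrakk> \<Longrightarrow> u = v"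
  by (auto simp: mono_arr_def Hom_def)

lemma epi_arrD:
  "\<lbrakk>epi_arr C e; e \<in> Hom C X Y; u \<in> Hom C Y Z; v \<in> Hom C Y Z; u \<cdot> e = v \<cdot> e\<rbrakk> \<Longrightarrow> u = v"
  by (auto simp: epi_arr_def Hom_def)

lemma iso_arrE:
  assumes "iso_arr C f" "f \<in> Hom C X Y"
  obtains g where "g \<in> Hom C Y X" "g \<cdot> f = Id C X" "f \<cdot> g = Id C Y"
  using assms by (auto simp: iso_arr_def Hom_def)

end

section \<open>Images and embeddings in an orean form\<close>

context orean_form
begin

lemma push_closed: "\<lbrakk>f \<in> Hom C X Y; S \<in> carrier (fibre F X)\<rbrakk> \<Longrightarrow> push F f S \<in> carrier (fibre F Y)"
  using transport[THEN galois_connection.axioms(1), THEN connection.lower_closed] by force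

lemma push_le_iff:
  "\<lbrakk>f \<in> Hom C X Y; S \<in> carrier (fibre F X); U \<in> carrier (fibre F Y)\<rbrakk>
    \<Longrightarrow> push F f S \<sqsubseteq>\<^bsub>fibre F Y\<^esub> U \<longleftrightarrow> S \<sqsubseteq>\<^bsub>fibre F X\<^esub> pull F f U"
  using transport[THEN galois_connection.galois_property] by force

lemma push_mono:
  "\<lbrakk>f \<in> Hom C X Y; S \<in> carrier (fibre F X); R \<in> carrier (fibre F X); S \<sqsubseteq>\<^bsub>fibre F X\<^esub> R\<rbrakk>
    \<Longrightarrow> push F f S \<sqsubseteq>\<^bsub>fibre F Y\<^esub> push F f R"
  using use_iso2[OF transport[THEN galois_connection.lower_iso]] by force

lemma Hom_ObjD: "f \<in> Hom C X Y \<Longrightarrow> X \<in> Obj C \<and> Y \<in> Obj C"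
  using Dom_Obj Cod_Obj by (auto simp: Hom_def)

lemma Im_eq: "f \<in> Hom C X Y \<Longrightarrow> Im C F f = push F f \<top>\<^bsub>fibre F X\<^esub>"
  by (simp add: Im_def Hom_def)

lemma Im_closed:
  assumes "f \<in> Hom C X Y"
  shows "Im C F f \<in> carrier (fibre F Y)"
proof -
  interpret X: bounded_lattice "fibre F X"
    using assms Hom_ObjD fibre_lattice by blast
  show ?thesis
    using assms by (simp add: Im_eq push_closed)
qed

lemma Im_Comp:
  assumes "f \<in> Hom C X Y" "g \<in> Hom C Y Z"
  shows "Im C F (g \<cdot> f) = push F g (Im C F f)"
proof -
  interpret X: bounded_lattice "fibre F X"
    using assms Hom_ObjD fibre_lattice by blast
  show ?thesis
    using assms by (simp add: Im_eq[OF Comp_Hom] Im_eq push_Comp)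
qed

lemma Im_Comp_le:
  assumes "f \<in> Hom C X Y" "g \<in> Hom C Y Z"
  shows "Im C F (g \<cdot> f) \<sqsubseteq>\<^bsub>fibre F Z\<^esub> Im C F g"
proof -
  interpret Y: bounded_lattice "fibre F Y"
    using assms Hom_ObjD fibre_lattice by blast
  show ?thesis
    using assms by (simp add: Im_Comp) (simp add: Im_eq[of g] Im_closed push_mono)
qed

text \<open>The reason is the right inverse: \<open>f \<cdot> g\<close> is an identity, with image
  \<top>, and the image of a composite lies below that of its last factor.\<close>

lemma iso_Im:
  assumes "iso_arr C f" "f \<in> Hom C X Y"
  shows "Im C F f = \<top>\<^bsub>fibre F Y\<^esub>"
proof -
  obtain g where g: "g \<in> Hom C Y X" "f \<cdot> g = Id C Y"
    using assms by (rule iso_arrE)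
  interpret Y: bounded_lattice "fibre F Y"
    using assms Hom_ObjD fibre_lattice by blast
  have "Im C F (Id C Y) = \<top>\<^bsub>fibre F Y\<^esub>"
    using assms Hom_ObjD Im_eq[OF Id_Hom] by (simp add: push_Id)
  then have "\<top>\<^bsub>fibre F Y\<^esub> \<sqsubseteq>\<^bsub>fibre F Y\<^esub> Im C F f"
    using Im_Comp_le[OF g(1) assms(2)] g(2) by simp
  then show ?thesis
    using Im_closed[OF assms(2)] by (simp add: Y.le_antisym)
qed

text \<open>An embedding determines its object and cluster, namely its codomain and its image, and
  is itself a witness of conormality; so the class is described by the universal property
  alone.\<close>

lemma embeddings_iff:
  "m \<in> embeddings C F \<longleftrightarrow> m \<in> Arr C \<and>
    (\<forall>f \<in> Arr C. Cod C f = Cod C m \<and> Im C F f \<sqsubseteq>\<^bsub>fibre F (Cod C m)\<^esub> Im C F m \<longrightarrow>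
      (\<exists>!h. h \<in> Hom C (Dom C f) (Dom C m) \<and> f = m \<cdot> h))"
  by (auto simp: embeddings_def embedding_of_def conormal_def)

lemma embeddings_factor:
  assumes "m \<in> embeddings C F" "m \<in> Hom C A X" "f \<in> Hom C W X"
    and "Im C F f \<sqsubseteq>\<^bsub>fibre F X\<^esub> Im C F m"
  obtains h where "h \<in> Hom C W A" "f = m \<cdot> h"
  using assms that unfolding embeddings_iff Hom_def by blast

text \<open>The arrow \<open>m \<cdot> u\<close> has image below that of \<open>m\<close>, so its
  factorization through \<open>m\<close> is unique; \<open>u\<close> and \<open>v\<close> are two
  such factorizations.\<close>

lemma embeddings_mono:
  assumes "m \<in> embeddings C F"
  shows "mono_arr C m"
proof (rule mono_arrI)
  have m: "m \<in> Arr C"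
    using assms by (simp add: embeddings_iff)
  then show "m \<in> Hom C (Dom C m) (Cod C m)"
    by (rule arr_in_Hom)
  fix W u v
  assume u: "u \<in> Hom C W (Dom C m)" and v: "v \<in> Hom C W (Dom C m)" and eq: "m \<cdot> u = m \<cdot> v"
  have mu: "m \<cdot> u \<in> Arr C" "Dom C (m \<cdot> u) = W" "Cod C (m \<cdot> u) = Cod C m"
    using Comp_Hom[OF u arr_in_Hom[OF m]] by (simp_all add: Hom_def)
  then have "\<exists>!h. h \<in> Hom C W (Dom C m) \<and> m \<cdot> u = m \<cdot> h"
    using assms[unfolded embeddings_iff, THEN conjunct2, rule_format, OF mu(1)]
      Im_Comp_le[OF u arr_in_Hom[OF m]] by simp
  then show "u = v"
    using u v eq by blast
qed

text \<open>Monicity takes the place of uniqueness, leaving just the existence of factorizations to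
  check.\<close>

lemma embeddingsI:
  assumes "mono_arr C m" "m \<in> Hom C A X"
    and "\<And>f W. \<lbrakk>f \<in> Hom C W X; Im C F f \<sqsubseteq>\<^bsub>fibre F X\<^esub> Im C F m\<rbrakk> \<Longrightarrow> \<exists>h \<in> Hom C W A. f = m \<cdot> h"
  shows "m \<in> embeddings C F"
  unfolding embeddings_iff
proof (intro conjI ballI impI)
  show "m \<in> Arr C"
    using assms(2) by (simp add: Hom_def)
  fix f
  assume f: "f \<in> Arr C" "Cod C f = Cod C m \<and> Im C F f \<sqsubseteq>\<^bsub>fibre F (Cod C m)\<^esub> Im C F m"
  then obtain h where "h \<in> Hom C (Dom C f) A" "f = m \<cdot> h"
    using assms(2,3) arr_in_Hom[OF f(1)] by (auto simp: Hom_def)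
  then show "\<exists>!h. h \<in> Hom C (Dom C f) (Dom C m) \<and> f = m \<cdot> h"
    using mono_arrD[OF assms(1,2)] assms(2) by (auto simp: Hom_def)
qed

lemma iso_embeddings:
  assumes "iso_arr C i"
  shows "i \<in> embeddings C F"
proof -
  have i: "i \<in> Hom C (Dom C i) (Cod C i)"
    using assms by (simp add: iso_arr_def Hom_def)
  obtain j where j: "j \<in> Hom C (Cod C i) (Dom C i)" "j \<cdot> i = Id C (Dom C i)"
      "i \<cdot> j = Id C (Cod C i)"
    using assms i by (rule iso_arrE)
  have "mono_arr C i"
  proof (rule mono_arrI[OF i])
    fix W u v
    assume u: "u \<in> Hom C W (Dom C i)" and v: "v \<in> Hom C W (Dom C i)" and eq: "i \<cdot> u = i \<cdot> v"
    have "u = j \<cdot> (i \<cdot> u)"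
      using Comp_assoc[OF u i j(1)] j(2) Id_Comp[OF u] by simp
    also have "\<dots> = v"
      using Comp_assoc[OF v i j(1)] j(2) Id_Comp[OF v] eq by simp
    finally show "u = v" .
  qed
  then show ?thesis
  proof (rule embeddingsI[OF _ i])
    fix f W
    assume f: "f \<in> Hom C W (Cod C i)"
    then show "\<exists>h \<in> Hom C W (Dom C i). f = i \<cdot> h"
      using i j Comp_Hom[OF f j(1)] Comp_assoc[OF f j(1) i] Id_Comp[OF f] by force
  qed
qed

end

section \<open>Embeddings and quotients of a noetherian form\<close>

context noetherian_form
begin

lemma image_factorization:
  assumes "f \<in> Hom C X Y"
  obtains e m A where "e \<in> quotients C F" "m \<in> embeddings C F" "e \<in> Hom C X A" "m \<in> Hom C A Y"
    "f = m \<cdot> e" "Ker C F e = Ker C F f" "Im C F m = Im C F f"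
proof -
  obtain e m where "quotient_of C F X (Ker C F f) e" "embedding_of C F Y (Im C F f) m"
      "Dom C m = Cod C e" "f = m \<cdot> e"
    using form_factorization[OF assms] by blast
  then show thesis
    by (intro that[of e m "Cod C e"])
      (auto simp: embeddings_def quotients_def Hom_def quotient_of_def embedding_of_def)
qed

text \<open>
  The embedding part of the factorization of \<open>m\<close> has the same image as \<open>m\<close>, so it is
  isomorphic to \<open>m\<close> and the quotient part, whose kernel is that of \<open>m\<close>, is invertible.
\<close>

lemma embeddings_Ker:
  assumes "m \<in> embeddings C F" "m \<in> Hom C A X"
  shows "Ker C F m = \<bottom>\<^bsub>fibre F A\<^esub>"
proof -
  obtain e n B where e: "e \<in> quotients C F" "e \<in> Hom C A B" and n: "n \<in> embeddings C F" "n \<in> Hom C B X"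
    and m: "m = n \<cdot> e" "Ker C F e = Ker C F m" "Im C F n = Im C F m"
    using image_factorization[OF assms(2)] by metis
  interpret X: bounded_lattice "fibre F X"
    using assms Hom_ObjD fibre_lattice by blast
  have "Im C F n \<sqsubseteq>\<^bsub>fibre F X\<^esub> Im C F m"
    using m(3) Im_closed[OF n(2)] by simp
  then obtain k where k: "k \<in> Hom C B A" "n = m \<cdot> k"
    using embeddings_factor[OF assms n(2)] by metis
  have "m \<cdot> (k \<cdot> e) = m \<cdot> Id C A"
    using k m(1) e(2) assms(2) n(2) by (metis Comp_assoc Comp_Id)
  then have ke: "k \<cdot> e = Id C A"
    using mono_arrD[OF embeddings_mono[OF assms(1)] assms(2)] k e Comp_Hom Id_Hom Hom_ObjD by metis
  have "n \<cdot> (e \<cdot> k) = n \<cdot> Id C B"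
    using k m(1) e(2) n(2) by (metis Comp_assoc Comp_Id)
  then have "e \<cdot> k = Id C B"
    using mono_arrD[OF embeddings_mono[OF n(1)] n(2)] k e Comp_Hom Id_Hom Hom_ObjD by metis
  with ke have "iso_arr C e"
    using k e by (auto simp: iso_arr_def Hom_def)
  \<comment> \<open>\<open>iso_Im\<close> in the opposite form says that an isomorphism has kernel
    \<bottom>.\<close>
  interpret op: orean_form "op_cat C" "op_form F"
    by (rule orean_form_op)
  show ?thesis
    using op.iso_Im[of e B A] \<open>iso_arr C e\<close> e(2) m(2) by simp
qed

text \<open>Since \<open>n\<close> has kernel \<bottom>, (N1) shows that pulling back a pushed
  cluster along \<open>n\<close> returns it, so \<open>push F n\<close> reflects the order. An arrow
  with image below that of \<open>n \<cdot> m\<close> factors through \<open>n\<close> by some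
  \<open>h\<close>, and cancelling \<open>push F n\<close> puts the image of \<open>h\<close> below
  that of \<open>m\<close>.\<close>

lemma embeddings_Comp:
  assumes m: "m \<in> embeddings C F" "m \<in> Hom C A X" and n: "n \<in> embeddings C F" "n \<in> Hom C X Y"
  shows "n \<cdot> m \<in> embeddings C F"
proof (rule embeddingsI)
  show nm: "n \<cdot> m \<in> Hom C A Y"
    using m n Comp_Hom by blast
  show "mono_arr C (n \<cdot> m)"
  proof (rule mono_arrI[OF nm])
    fix W u v
    assume uv: "u \<in> Hom C W A" "v \<in> Hom C W A" and eq: "(n \<cdot> m) \<cdot> u = (n \<cdot> m) \<cdot> v"
    have "n \<cdot> (m \<cdot> u) = n \<cdot> (m \<cdot> v)"
      using eq Comp_assoc[OF _ m(2) n(2)] uv by simp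
    then have "m \<cdot> u = m \<cdot> v"
      using mono_arrD[OF embeddings_mono[OF n(1)] n(2)] Comp_Hom uv m(2) by blast
    then show "u = v"
      using mono_arrD[OF embeddings_mono[OF m(1)] m(2)] uv by blast
  qed
next
  fix f W
  assume f: "f \<in> Hom C W Y" and le: "Im C F f \<sqsubseteq>\<^bsub>fibre F Y\<^esub> Im C F (n \<cdot> m)"
  interpret X: bounded_lattice "fibre F X"
    using m Hom_ObjD fibre_lattice by blast
  interpret Y: bounded_lattice "fibre F Y"
    using n Hom_ObjD fibre_lattice by blast
  have nm: "n \<cdot> m \<in> Hom C A Y"
    using m n Comp_Hom by blast
  have "Im C F f \<sqsubseteq>\<^bsub>fibre F Y\<^esub> Im C F n"
    using le Im_Comp_le[OF m(2) n(2)] Im_closed f n nm by (meson Y.le_trans)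
  then obtain h where h: "h \<in> Hom C W X" "f = n \<cdot> h"
    using embeddings_factor[OF n f] by metis
  have "push F n (Im C F h) \<sqsubseteq>\<^bsub>fibre F Y\<^esub> push F n (Im C F m)"
    using le h m n by (simp add: Im_Comp)
  then have "Im C F h \<sqsubseteq>\<^bsub>fibre F X\<^esub> pull F n (push F n (Im C F m))"
    using h m n Im_closed push_closed push_le_iff by metis
  also have "pull F n (push F n (Im C F m)) = Im C F m \<squnion>\<^bsub>fibre F X\<^esub> \<bottom>\<^bsub>fibre F X\<^esub>"
    using pull_push[OF n(2) Im_closed[OF m(2)]] embeddings_Ker[OF n] by simp
  also have "\<dots> = Im C F m"
    using Im_closed[OF m(2)] by (intro X.le_antisym) (auto intro: X.join_le X.join_left)
  finally obtain k where k: "k \<in> Hom C W A" "h = m \<cdot> k"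
    using embeddings_factor[OF m h(1)] by metis
  then show "\<exists>k \<in> Hom C W A. f = (n \<cdot> m) \<cdot> k"
    using h(2) Comp_assoc[OF k(1) m(2) n(2)] by metis
qed

text \<open>The pullback is represented by an embedding of the meet of the two images.\<close>

lemma embeddings_pullback:
  assumes m: "m \<in> embeddings C F" "m \<in> Hom C A X" and n: "n \<in> embeddings C F" "n \<in> Hom C B X"
  obtains p q where "is_pullback C m n p q" "m \<cdot> p \<in> embeddings C F"
proof -
  have "X \<in> Obj C"
    using m Hom_ObjD by blast
  interpret X: bounded_lattice "fibre F X"
    using \<open>X \<in> Obj C\<close> fibre_lattice by blast
  let ?S = "Im C F m \<sqinter>\<^bsub>fibre F X\<^esub> Im C F n"
  have Im_mn: "Im C F m \<in> carrier (fibre F X)" "Im C F n \<in> carrier (fibre F X)"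
    using m n Im_closed by auto
  have "conormal C F X (Im C F m)" "conormal C F X (Im C F n)"
    using m n by (auto simp: conormal_def Hom_def)
  \<comment> \<open>(N3) only promises some arrow whose image is the meet; its image factorization
    supplies an embedding with that image.\<close>
  then obtain f W where f: "f \<in> Hom C W X" "Im C F f = ?S"
    using conormal_meet[OF \<open>X \<in> Obj C\<close>] unfolding conormal_def Hom_def by blast
  obtain i P where i: "i \<in> embeddings C F" "i \<in> Hom C P X" "Im C F i = ?S"
    using image_factorization[OF f(1)] f(2) by metis
  have "Im C F i \<sqsubseteq>\<^bsub>fibre F X\<^esub> Im C F m" "Im C F i \<sqsubseteq>\<^bsub>fibre F X\<^esub> Im C F n"
    using Im_mn i(3) by (simp_all add: X.meet_left X.meet_right)
  then obtain p q where p: "p \<in> Hom C P A" "i = m \<cdot> p" and q: "q \<in> Hom C P B" "i = n \<cdot> q"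
    using embeddings_factor[OF m i(2)] embeddings_factor[OF n i(2)] by metis
  have "is_pullback C m n p q"
    unfolding is_pullback_def
  proof (intro conjI allI ballI impI)
    fix V u v
    assume "u \<in> Hom C V (Dom C m)" "v \<in> Hom C V (Dom C n)" and eq: "m \<cdot> u = n \<cdot> v"
    then have uv: "u \<in> Hom C V A" "v \<in> Hom C V B"
      using m n by (auto simp: Hom_def)
    have mu: "m \<cdot> u \<in> Hom C V X"
      using uv m Comp_Hom by blast
    have "Im C F (m \<cdot> u) \<sqsubseteq>\<^bsub>fibre F X\<^esub> Im C F i"
      unfolding i(3)
    proof (rule X.meet_le)
      show "Im C F (m \<cdot> u) \<sqsubseteq>\<^bsub>fibre F X\<^esub> Im C F m"
        using Im_Comp_le uv m by blast
      show "Im C F (m \<cdot> u) \<sqsubseteq>\<^bsub>fibre F X\<^esub> Im C F n"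
        using Im_Comp_le uv n eq by metis
    qed (use Im_mn mu Im_closed in auto)
    then obtain h where h: "h \<in> Hom C V P" "m \<cdot> u = i \<cdot> h"
      using embeddings_factor[OF i(1,2) mu] by metis
    have "m \<cdot> (p \<cdot> h) = m \<cdot> u"
      using h(2) p(2) Comp_assoc[OF h(1) p(1) m(2)] by simp
    then have "p \<cdot> h = u"
      by (rule mono_arrD[OF embeddings_mono[OF m(1)] m(2) Comp_Hom[OF h(1) p(1)] uv(1)])
    moreover have "n \<cdot> (q \<cdot> h) = n \<cdot> v"
      using h(2) q(2) eq Comp_assoc[OF h(1) q(1) n(2)] by simp
    then have "q \<cdot> h = v"
      by (rule mono_arrD[OF embeddings_mono[OF n(1)] n(2) Comp_Hom[OF h(1) q(1)] uv(2)])
    moreover have "h' = h" if "h' \<in> Hom C V P" "p \<cdot> h' = u" for h'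
    proof (rule mono_arrD[OF embeddings_mono[OF i(1)] i(2) that(1) h(1)])
      show "i \<cdot> h' = i \<cdot> h"
        using h(2) p(2) Comp_assoc[OF that(1) p(1) m(2)] that(2) by simp
    qed
    moreover have "Dom C p = P"
      using p by (simp add: Hom_def)
    ultimately show "\<exists>!h. h \<in> Hom C V (Dom C p) \<and> p \<cdot> h = u \<and> q \<cdot> h = v"
      using h(1) by blast
  qed (use m n p q in \<open>auto simp: Hom_def\<close>)
  \<comment> \<open>\<open>m \<cdot> p\<close> is the embedding \<open>i\<close>; keeping this fact
    is what later brings the apex into the subcategory.\<close>
  then show thesis
    using that i p by metis
qed

lemma embeddings_has_pullbacks: "has_pullbacks_of C (embeddings C F)"
  unfolding has_pullbacks_of_def
proof (intro ballI impI)
  fix m n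
  assume "m \<in> embeddings C F" "n \<in> embeddings C F" "Cod C m = Cod C n"
  moreover from this have "m \<in> Hom C (Dom C m) (Cod C n)" "n \<in> Hom C (Dom C n) (Cod C n)"
    by (auto simp: Hom_def embeddings_iff)
  ultimately show "\<exists>p q. is_pullback C m n p q"
    using embeddings_pullback by metis
qed

text \<open>As \<open>m\<close> has kernel \<bottom>, \<open>m \<cdot> u\<close> and
  \<open>u\<close> have the same kernel. The square puts the kernel of \<open>e\<close> below it, so
  \<open>u\<close> factors through the quotient \<open>e\<close>; the other triangle follows by
  cancelling the epimorphism \<open>e\<close>.\<close>

lemma quotients_embeddings_orthogonal:
  assumes e: "e \<in> quotients C F" "e \<in> Hom C A B" and m: "m \<in> embeddings C F" "m \<in> Hom C X Y"
    and uv: "u \<in> Hom C A X" "v \<in> Hom C B Y" and eq: "m \<cdot> u = v \<cdot> e"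
  shows "\<exists>!d. d \<in> Hom C B X \<and> d \<cdot> e = u \<and> m \<cdot> d = v"
proof -
  interpret op: orean_form "op_cat C" "op_form F"
    by (rule orean_form_op)
  have epi: "epi_arr C e"
    using op.embeddings_mono e by simp
  \<comment> \<open>The bound on images of composites in the opposite category, read back in
    \<open>C\<close>: the fibre order is reversed and the first arrow becomes the last.\<close>
  have "Ker C F e \<sqsubseteq>\<^bsub>fibre F A\<^esub> Ker C F (v \<cdot> e)"
    using op.Im_Comp_le[of v Y B e A] e uv by simp
  also have "Ker C F (v \<cdot> e) = pull F u (Ker C F m)"
    using eq op.Im_Comp[of m Y X u A] uv m by simp
  also have "\<dots> = Ker C F u"
    using embeddings_Ker[OF m] op.Im_eq[of u X A] uv by simp
  finally obtain d where d: "d \<in> Hom C B X" "u = d \<cdot> e"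
    using op.embeddings_factor[of e B A u X] e uv by auto
  have "(m \<cdot> d) \<cdot> e = v \<cdot> e"
    using d eq Comp_assoc[OF e(2) d(1) m(2)] by simp
  then have "m \<cdot> d = v"
    by (rule epi_arrD[OF epi e(2) Comp_Hom[OF d(1) m(2)] uv(2)])
  then show ?thesis
    using epi_arrD[OF epi e(2)] d by blast
qed

text \<open>Factorization and orthogonality are self-dual; the remaining clauses come in pairs, the
  one for quotients being the one for embeddings in the opposite form.\<close>

lemma induced_factorization_system:
  "proper_factorization_system C (quotients C F) (embeddings C F)"
proof -
  interpret op: noetherian_form "op_cat C" "op_form F"
    by (rule noetherian_form_op)
  have quot: "e \<in> Arr C" if "e \<in> quotients C F" for e
    using that op.embeddings_iff by simp
  have emb: "m \<in> Arr C" if "m \<in> embeddings C F" for m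
    using that embeddings_iff by simp
  show ?thesis
  proof
    show "epi_arr C e" if "e \<in> quotients C F" for e
      using that op.embeddings_mono by simp
    show "mono_arr C m" if "m \<in> embeddings C F" for m
      using that by (rule embeddings_mono)
    show "f \<in> quotients C F" if "iso_arr C f" for f
      using that op.iso_embeddings by simp
    show "f \<in> embeddings C F" if "iso_arr C f" for f
      using that by (rule iso_embeddings)
    show "e' \<cdot> e \<in> quotients C F"
      if "e \<in> quotients C F" "e' \<in> quotients C F" "Cod C e = Dom C e'" for e e'
      using that quot op.embeddings_Comp[of e' "Cod C e'" "Dom C e'" e "Dom C e"]
      by (simp add: Hom_def)
    show "m' \<cdot> m \<in> embeddings C F"
      if "m \<in> embeddings C F" "m' \<in> embeddings C F" "Cod C m = Dom C m'" for m m'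
      using that emb embeddings_Comp[of m "Dom C m" "Cod C m" m' "Cod C m'"]
      by (simp add: Hom_def)
    show "\<exists>e \<in> quotients C F. \<exists>m \<in> embeddings C F. Dom C m = Cod C e \<and> f = m \<cdot> e"
      if f: "f \<in> Arr C" for f
    proof (rule image_factorization[OF arr_in_Hom[OF f]])
      fix e m A
      assume "e \<in> quotients C F" "m \<in> embeddings C F" "e \<in> Hom C (Dom C f) A"
        "m \<in> Hom C A (Cod C f)" "f = m \<cdot> e"
      then show ?thesis
        by (auto simp: Hom_def)
    qed
    show "\<exists>!d. d \<in> Hom C (Cod C e) (Dom C m) \<and> d \<cdot> e = u \<and> m \<cdot> d = v"
      if "e \<in> quotients C F" "m \<in> embeddings C F" "u \<in> Hom C (Dom C e) (Dom C m)"
        "v \<in> Hom C (Cod C e) (Cod C m)" "m \<cdot> u = v \<cdot> e" for e m u v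
      using that quot emb by (intro quotients_embeddings_orthogonal) (auto intro: arr_in_Hom)
  qed
qed

end


section \<open>Full subcategories closed under embeddings and quotients\<close>

text \<open>Fullness is stable under passing to opposite categories, so comparison results proved
  here for pullbacks and monomorphisms apply to pushouts and epimorphisms as well.\<close>

locale full_subcategory = subcategory C D
  for C D :: "('o, 'a) category" +
  assumes Hom_eq: "\<lbrakk>X \<in> Obj C; Y \<in> Obj C\<rbrakk> \<Longrightarrow> Hom C X Y = Hom D X Y"

lemma (in full_replete_subcategory) full_subcategory: "full_subcategory C D"
  by unfold_locales (rule full)

lemma (in full_subcategory) full_subcategory_op: "full_subcategory (op_cat C) (op_cat D)"
proof -
  interpret C: category "op_cat C"
    by (rule sub.category_op)
  interpret D: category "op_cat D"
    by (rule ambient.category_op)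
  show ?thesis
    by unfold_locales
      (use Obj_subset Arr_subset in \<open>auto simp: Dom_eq Cod_eq Id_eq Comp_eq Hom_eq\<close>)
qed

section \<open>Monomorphisms, isomorphisms, pullbacks and factorizations in a full
  subcategory\<close>

context full_subcategory
begin

lemma Hom_subset: "Hom C X Y \<subseteq> Hom D X Y"
  using Arr_subset Dom_eq Cod_eq by (auto simp: Hom_def)

lemma Hom_ObjD: "f \<in> Hom C X Y \<Longrightarrow> X \<in> Obj C \<and> Y \<in> Obj C"
  using sub.Dom_Obj sub.Cod_Obj by (auto simp: Hom_def)

text \<open>By fullness, whether an arrow of \<open>D\<close> belongs to \<open>C\<close> is a
  question about its ends; the closure conditions, which speak of objects, thereby place arrows in
  \<open>C\<close>.\<close>

lemma Arr_iff: "f \<in> Arr C \<longleftrightarrow> f \<in> Arr D \<and> Dom D f \<in> Obj C \<and> Cod D f \<in> Obj C"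
proof
  show "f \<in> Arr C" if "f \<in> Arr D \<and> Dom D f \<in> Obj C \<and> Cod D f \<in> Obj C"
    using that Hom_eq[of "Dom D f" "Cod D f"] by (auto simp: Hom_def)
qed (use Arr_subset Dom_eq Cod_eq sub.Dom_Obj sub.Cod_Obj in force)

text \<open>In \<open>C\<close> there are fewer pairs of arrows to cancel.\<close>

lemma mono_arr_sub:
  assumes "mono_arr D m" "m \<in> Arr C"
  shows "mono_arr C m"
proof (rule sub.mono_arrI[OF sub.arr_in_Hom[OF assms(2)]])
  fix W u v
  assume u: "u \<in> Hom C W (Dom C m)" and v: "v \<in> Hom C W (Dom C m)"
    and "m \<cdot>\<^bsub>C\<^esub> u = m \<cdot>\<^bsub>C\<^esub> v"
  then have "m \<cdot>\<^bsub>D\<^esub> u = m \<cdot>\<^bsub>D\<^esub> v"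
    using Comp_eq[OF u sub.arr_in_Hom[OF assms(2)]] Comp_eq[OF v sub.arr_in_Hom[OF assms(2)]]
    by simp
  then show "u = v"
    using ambient.mono_arrD[OF assms(1)] u v sub.arr_in_Hom[OF assms(2)] Hom_subset by blast
qed

text \<open>The ends of \<open>f\<close> lie in \<open>C\<close>, so fullness puts an inverse from
  \<open>D\<close> into \<open>C\<close>. This is conservativity of the inclusion.\<close>

lemma iso_arr_sub:
  assumes "f \<in> Arr C"
  shows "iso_arr C f \<longleftrightarrow> iso_arr D f"
proof -
  have f: "f \<in> Hom C (Dom D f) (Cod D f)"
    using assms by (simp add: Hom_def Dom_eq Cod_eq)
  then have O: "Dom D f \<in> Obj C" "Cod D f \<in> Obj C"
    using Hom_ObjD by auto
  show ?thesis
    using assms O Arr_subset Comp_eq[OF f] Comp_eq[OF _ f] Hom_eq[OF O(2,1)]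
    by (fastforce simp: iso_arr_def Dom_eq Cod_eq Id_eq)
qed

text \<open>With the apex in \<open>C\<close>, fullness supplies the projections and every mediating
  arrow from an object of \<open>C\<close>.\<close>

lemma is_pullback_sub:
  assumes pb: "is_pullback D f g p q"
    and C: "f \<in> Arr C" "g \<in> Arr C" "Dom D p \<in> Obj C"
  shows "is_pullback C f g p q"
proof -
  have f: "f \<in> Hom C (Dom D f) (Cod D f)" and g: "g \<in> Hom C (Dom D g) (Cod D g)"
    using C by (simp_all add: Hom_def Dom_eq Cod_eq)
  then have O: "Dom D f \<in> Obj C" "Dom D g \<in> Obj C"
    using Hom_ObjD by auto
  have p: "p \<in> Hom C (Dom D p) (Dom D f)" and q: "q \<in> Hom C (Dom D p) (Dom D g)"
    using pb C(3) O by (simp_all add: is_pullback_def Hom_eq)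
  then have dom: "Dom C p = Dom D p"
    by (simp add: Hom_def)
  show ?thesis
    unfolding is_pullback_def dom
  proof (intro conjI allI ballI impI)
    show "f \<cdot>\<^bsub>C\<^esub> p = g \<cdot>\<^bsub>C\<^esub> q"
      using pb Comp_eq[OF p f] Comp_eq[OF q g] by (simp add: is_pullback_def)
    fix W u v
    assume "u \<in> Hom C W (Dom C f)" "v \<in> Hom C W (Dom C g)" and eq: "f \<cdot>\<^bsub>C\<^esub> u = g \<cdot>\<^bsub>C\<^esub> v"
    then have u: "u \<in> Hom C W (Dom D f)" and v: "v \<in> Hom C W (Dom D g)"
      using C by (simp_all add: Dom_eq)
    have W: "W \<in> Obj C"
      using u Hom_ObjD by blast
    have "f \<cdot>\<^bsub>D\<^esub> u = g \<cdot>\<^bsub>D\<^esub> v"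
      using eq Comp_eq[OF u f] Comp_eq[OF v g] by simp
    then have "\<exists>!h. h \<in> Hom D W (Dom D p) \<and> p \<cdot>\<^bsub>D\<^esub> h = u \<and> q \<cdot>\<^bsub>D\<^esub> h = v"
      using pb u v Hom_subset unfolding is_pullback_def by blast
    then show "\<exists>!h. h \<in> Hom C W (Dom D p) \<and> p \<cdot>\<^bsub>C\<^esub> h = u \<and> q \<cdot>\<^bsub>C\<^esub> h = v"
      using Hom_eq[OF W C(3)] Comp_eq[OF _ p] Comp_eq[OF _ q] by (metis (no_types, lifting))
  qed (use pb C p q in \<open>simp_all add: is_pullback_def Dom_eq Cod_eq\<close>)
qed

text \<open>Both squares are pullbacks in the subcategory, so they are isomorphic there.\<close>

lemma is_pullback_ambient:
  assumes pb: "is_pullback C f g p q"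
    and pb': "is_pullback D f g p' q'" "Dom D p' \<in> Obj C"
  shows "is_pullback D f g p q"
proof -
  let ?P = "Dom D p" and ?P' = "Dom D p'"
  have C: "f \<in> Arr C" "g \<in> Arr C" "p \<in> Arr C"
    using pb by (auto simp: is_pullback_def Hom_def)
  have f: "f \<in> Hom C (Dom D f) (Cod D f)" and g: "g \<in> Hom C (Dom D g) (Cod D g)"
    using C by (simp_all add: Hom_def Dom_eq Cod_eq)
  have p: "p \<in> Hom C ?P (Dom D f)" and q: "q \<in> Hom C ?P (Dom D g)"
    using pb C by (simp_all add: is_pullback_def Dom_eq)
  have O: "?P \<in> Obj C" "Dom D f \<in> Obj C" "Dom D g \<in> Obj C"
    using p q Hom_ObjD by auto
  have p': "p' \<in> Hom D ?P' (Dom D f)" and q': "q' \<in> Hom D ?P' (Dom D g)"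
    using pb' by (simp_all add: is_pullback_def)
  have pD: "p \<in> Hom D ?P (Dom D f)" and qD: "q \<in> Hom D ?P (Dom D g)"
    using p q Hom_subset by auto
  have p'C: "p' \<in> Hom C ?P' (Dom D f)" and q'C: "q' \<in> Hom C ?P' (Dom D g)"
    using p' q' pb'(2) O by (simp_all add: Hom_eq)
  have fp: "f \<cdot>\<^bsub>D\<^esub> p = g \<cdot>\<^bsub>D\<^esub> q"
    using pb Comp_eq[OF p f] Comp_eq[OF q g] by (simp add: is_pullback_def)
  have "f \<cdot>\<^bsub>D\<^esub> p' = g \<cdot>\<^bsub>D\<^esub> q'"
    using pb'(1) by (simp add: is_pullback_def)
  then have "f \<cdot>\<^bsub>C\<^esub> p' = g \<cdot>\<^bsub>C\<^esub> q'"
    using Comp_eq[OF p'C f] Comp_eq[OF q'C g] by simp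
  \<comment> \<open>\<open>k\<close> comes from the universal property in \<open>C\<close>, which
    applies since \<open>p'\<close> and \<open>q'\<close> have their common domain there;
    \<open>j\<close> below comes from the one in \<open>D\<close>.\<close>
  then have "\<exists>k. k \<in> Hom C ?P' ?P \<and> p \<cdot>\<^bsub>C\<^esub> k = p' \<and> q \<cdot>\<^bsub>C\<^esub> k = q'"
    using pb p'C q'C C unfolding is_pullback_def by (simp add: Dom_eq) blast
  then obtain k where kC: "k \<in> Hom C ?P' ?P" and "p \<cdot>\<^bsub>C\<^esub> k = p'" "q \<cdot>\<^bsub>C\<^esub> k = q'"
    by blast
  then have k: "k \<in> Hom D ?P' ?P" "p \<cdot>\<^bsub>D\<^esub> k = p'" "q \<cdot>\<^bsub>D\<^esub> k = q'"
    using Hom_subset Comp_eq[OF kC p] Comp_eq[OF kC q] by auto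
  obtain j where j: "j \<in> Hom D ?P ?P'" "p' \<cdot>\<^bsub>D\<^esub> j = p" "q' \<cdot>\<^bsub>D\<^esub> j = q"
    using pb'(1) pD qD fp unfolding is_pullback_def by blast
  have kj: "k \<cdot>\<^bsub>D\<^esub> j \<in> Hom C ?P ?P"
    using ambient.Comp_Hom[OF j(1) k(1)] O by (simp add: Hom_eq)
  have "p \<cdot>\<^bsub>D\<^esub> (k \<cdot>\<^bsub>D\<^esub> j) = p" "q \<cdot>\<^bsub>D\<^esub> (k \<cdot>\<^bsub>D\<^esub> j) = q"
    using ambient.Comp_assoc[OF j(1) k(1) pD] ambient.Comp_assoc[OF j(1) k(1) qD] k(2,3) j(2,3)
    by metis+
  then have kj_pq: "p \<cdot>\<^bsub>C\<^esub> (k \<cdot>\<^bsub>D\<^esub> j) = p" "q \<cdot>\<^bsub>C\<^esub> (k \<cdot>\<^bsub>D\<^esub> j) = q"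
    using Comp_eq[OF kj p] Comp_eq[OF kj q] by simp_all
  have id: "Id D ?P \<in> Hom C ?P ?P" "p \<cdot>\<^bsub>C\<^esub> Id D ?P = p" "q \<cdot>\<^bsub>C\<^esub> Id D ?P = q"
    using O(1) sub.Id_Hom sub.Comp_Id[OF p] sub.Comp_Id[OF q] by (simp_all add: Id_eq[symmetric])
  \<comment> \<open>Both \<open>k \<cdot> j\<close> and the identity mediate from the cone
    \<open>(p, q)\<close> to itself, a test made entirely in \<open>C\<close>.\<close>
  have "\<exists>!h. h \<in> Hom C ?P ?P \<and> p \<cdot>\<^bsub>C\<^esub> h = p \<and> q \<cdot>\<^bsub>C\<^esub> h = q"
    using pb p q C unfolding is_pullback_def by (simp add: Dom_eq)
  then have kj_id: "k \<cdot>\<^bsub>D\<^esub> j = Id D ?P"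
    using kj kj_pq id by blast
  show ?thesis
    unfolding is_pullback_def
  proof (intro conjI allI ballI impI)
    fix W u v
    assume u: "u \<in> Hom D W (Dom D f)" and v: "v \<in> Hom D W (Dom D g)"
      and eq: "f \<cdot>\<^bsub>D\<^esub> u = g \<cdot>\<^bsub>D\<^esub> v"
    have ex1: "\<exists>!h. h \<in> Hom D W ?P' \<and> p' \<cdot>\<^bsub>D\<^esub> h = u \<and> q' \<cdot>\<^bsub>D\<^esub> h = v"
      using pb'(1) u v eq unfolding is_pullback_def by blast
    then obtain h where h: "h \<in> Hom D W ?P'" "p' \<cdot>\<^bsub>D\<^esub> h = u" "q' \<cdot>\<^bsub>D\<^esub> h = v"
      by blast
    have "k \<cdot>\<^bsub>D\<^esub> h \<in> Hom D W ?P \<and> p \<cdot>\<^bsub>D\<^esub> (k \<cdot>\<^bsub>D\<^esub> h) = u \<and> q \<cdot>\<^bsub>D\<^esub> (k \<cdot>\<^bsub>D\<^esub> h) = v"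
      using ambient.Comp_Hom[OF h(1) k(1)] ambient.Comp_assoc[OF h(1) k(1) pD]
        ambient.Comp_assoc[OF h(1) k(1) qD] k(2,3) h(2,3) by metis
    \<comment> \<open>Existence came from \<open>k\<close>. Uniqueness is transported by
      \<open>j\<close>: \<open>j \<cdot> l\<close> has to be \<open>h\<close>, and \<open>k\<close>
      undoes \<open>j\<close>.\<close>
    moreover have "l = k \<cdot>\<^bsub>D\<^esub> h"
      if l: "l \<in> Hom D W ?P" "p \<cdot>\<^bsub>D\<^esub> l = u" "q \<cdot>\<^bsub>D\<^esub> l = v" for l
    proof -
      have "p' \<cdot>\<^bsub>D\<^esub> (j \<cdot>\<^bsub>D\<^esub> l) = u" "q' \<cdot>\<^bsub>D\<^esub> (j \<cdot>\<^bsub>D\<^esub> l) = v"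
        using ambient.Comp_assoc[OF l(1) j(1) p'] ambient.Comp_assoc[OF l(1) j(1) q'] j(2,3) l(2,3)
        by metis+
      then have "j \<cdot>\<^bsub>D\<^esub> l = h"
        using ex1 h ambient.Comp_Hom[OF l(1) j(1)] by blast
      then have "k \<cdot>\<^bsub>D\<^esub> h = (k \<cdot>\<^bsub>D\<^esub> j) \<cdot>\<^bsub>D\<^esub> l"
        using ambient.Comp_assoc[OF l(1) j(1) k(1)] by simp
      then show ?thesis
        using kj_id ambient.Id_Comp[OF l(1)] by simp
    qed
    ultimately show "\<exists>!h. h \<in> Hom D W ?P \<and> p \<cdot>\<^bsub>D\<^esub> h = u \<and> q \<cdot>\<^bsub>D\<^esub> h = v"
      by blast
  qed (use pb'(1) pD qD fp in \<open>simp_all add: is_pullback_def\<close>)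
qed

lemma cat_functor_inclusion: "cat_functor C D inclusion"
  by unfold_locales
    (use Obj_subset Hom_subset in \<open>auto simp: inclusion_def Id_eq Comp_eq\<close>)

text \<open>The middle object of a factorization is the domain of the right factor, hence in
  \<open>C\<close> by closure; both factors are then arrows of \<open>C\<close>. Diagonals lie in
  \<open>C\<close> by fullness.\<close>

lemma factorization_system_sub:
  assumes "proper_factorization_system D E M"
    and closed: "\<And>m. \<lbrakk>m \<in> M; Cod D m \<in> Obj C\<rbrakk> \<Longrightarrow> Dom D m \<in> Obj C"
  shows "proper_factorization_system C (E \<inter> Arr C) (M \<inter> Arr C)"
proof -
  interpret D: proper_factorization_system D E M
    by fact
  interpret op: full_subcategory "op_cat C" "op_cat D"
    by (rule full_subcategory_op)
  have Arr_Hom: "f \<in> Hom C (Dom C f) (Cod C f)" if "f \<in> Arr C" for f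
    using that by (rule sub.arr_in_Hom)
  show ?thesis
  proof
    show "epi_arr C e" if "e \<in> E \<inter> Arr C" for e
      using that op.mono_arr_sub[of e] D.left_epi by simp
    show "mono_arr C m" if "m \<in> M \<inter> Arr C" for m
      using that mono_arr_sub D.right_mono by blast
    show "f \<in> E \<inter> Arr C" if "iso_arr C f" for f
      using that iso_arr_sub[of f] D.iso_left by (auto simp: iso_arr_def)
    show "f \<in> M \<inter> Arr C" if "iso_arr C f" for f
      using that iso_arr_sub[of f] D.iso_right by (auto simp: iso_arr_def)
    have comp: "g \<cdot>\<^bsub>C\<^esub> f = g \<cdot>\<^bsub>D\<^esub> f \<and> g \<cdot>\<^bsub>C\<^esub> f \<in> Arr C"
      if "f \<in> Arr C" "g \<in> Arr C" "Cod C f = Dom C g" for f g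
      using that Comp_eq[of f "Dom C f" "Dom C g" g "Cod C g"]
        sub.Comp_Hom[of f "Dom C f" "Dom C g" g "Cod C g"] by (simp add: Hom_def)
    show "e' \<cdot>\<^bsub>C\<^esub> e \<in> E \<inter> Arr C"
      if "e \<in> E \<inter> Arr C" "e' \<in> E \<inter> Arr C" "Cod C e = Dom C e'" for e e'
      using that comp[of e e'] D.left_comp by (auto simp: Dom_eq Cod_eq)
    show "m' \<cdot>\<^bsub>C\<^esub> m \<in> M \<inter> Arr C"
      if "m \<in> M \<inter> Arr C" "m' \<in> M \<inter> Arr C" "Cod C m = Dom C m'" for m m'
      using that comp[of m m'] D.right_comp by (auto simp: Dom_eq Cod_eq)
    show "\<exists>e \<in> E \<inter> Arr C. \<exists>m \<in> M \<inter> Arr C. Dom C m = Cod C e \<and> f = m \<cdot>\<^bsub>C\<^esub> e"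
      if f: "f \<in> Arr C" for f
    proof -
      obtain e m where e: "e \<in> E" and m: "m \<in> M" and eq: "Dom D m = Cod D e" "f = m \<cdot>\<^bsub>D\<^esub> e"
        using D.factorization f Arr_subset by blast
      have arr: "e \<in> Arr D" "m \<in> Arr D"
        using D.left_epi[OF e] D.right_mono[OF m] by (auto simp: epi_arr_def mono_arr_def)
      then have "f \<in> Hom D (Dom D e) (Cod D m)"
        using ambient.Comp_Hom[of e "Dom D e" "Dom D m" m "Cod D m"] eq by (simp add: Hom_def)
      then have "Dom D e \<in> Obj C" "Cod D m \<in> Obj C"
        using f Arr_iff by (auto simp: Hom_def)
      moreover from this have "Dom D m \<in> Obj C"
        using closed m by blast
      ultimately have "e \<in> Arr C" "m \<in> Arr C"
        using arr eq by (auto simp: Arr_iff)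
      then show ?thesis
        using e m eq comp[of e m] by (intro bexI[of _ e] bexI[of _ m]) (simp_all add: Dom_eq Cod_eq)
    qed
    show "\<exists>!d. d \<in> Hom C (Cod C e) (Dom C m) \<and> d \<cdot>\<^bsub>C\<^esub> e = u \<and> m \<cdot>\<^bsub>C\<^esub> d = v"
      if e: "e \<in> E \<inter> Arr C" and m: "m \<in> M \<inter> Arr C" and u: "u \<in> Hom C (Dom C e) (Dom C m)"
        and v: "v \<in> Hom C (Cod C e) (Cod C m)" and eq: "m \<cdot>\<^bsub>C\<^esub> u = v \<cdot>\<^bsub>C\<^esub> e" for e m u v
    proof -
      have eC: "e \<in> Hom C (Dom C e) (Cod C e)" and mC: "m \<in> Hom C (Dom C m) (Cod C m)"
        using e m by (auto intro: Arr_Hom)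
      have O: "Cod C e \<in> Obj C" "Dom C m \<in> Obj C"
        using eC mC Hom_ObjD by auto
      have "m \<cdot>\<^bsub>D\<^esub> u = v \<cdot>\<^bsub>D\<^esub> e"
        using eq Comp_eq[OF u mC] Comp_eq[OF eC v] by simp
      then have "\<exists>!d. d \<in> Hom D (Cod C e) (Dom C m) \<and> d \<cdot>\<^bsub>D\<^esub> e = u \<and> m \<cdot>\<^bsub>D\<^esub> d = v"
        using D.orthogonal[of e m u v] e m u v Hom_subset by (auto simp: Dom_eq Cod_eq)
      then show ?thesis
        using Hom_eq[OF O] Comp_eq[OF eC] Comp_eq[OF _ mC] by (metis (no_types, lifting))
    qed
  qed
qed

end

section \<open>Embeddings, clusters and forms restricted to a closed subcategory\<close>

locale closed_subcategory = full_subcategory C D + form: noetherian_form D F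
  for C D :: "('o, 'a) category" and F :: "('o, 'a, 'c) form" +
  assumes embeddings_closed: "\<lbrakk>m \<in> embeddings D F; Cod D m \<in> Obj C\<rbrakk> \<Longrightarrow> Dom D m \<in> Obj C"
    and quotients_closed: "\<lbrakk>e \<in> quotients D F; Dom D e \<in> Obj C\<rbrakk> \<Longrightarrow> Cod D e \<in> Obj C"

text \<open>The two closure conditions are exchanged, one governing domains of embeddings, the other
  codomains of quotients. Statements about quotients in \<open>C\<close> are obtained through
  this.\<close>

lemma (in closed_subcategory) closed_subcategory_op:
  "closed_subcategory (op_cat C) (op_cat D) (op_form F)"
  by (intro closed_subcategory.intro closed_subcategory_axioms.intro full_subcategory_op
      form.noetherian_form_op) (auto intro: embeddings_closed quotients_closed)

context closed_subcategory
begin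

lemma Im_sub: "f \<in> Arr C \<Longrightarrow> Im C F f = Im D F f"
  by (simp add: Im_def Dom_eq)

lemma Ker_sub: "f \<in> Arr C \<Longrightarrow> Ker C F f = Ker D F f"
  by (simp add: Ker_def Cod_eq)

lemma embedding_of_arr_sub:
  assumes "embedding_of D F X S i" "X \<in> Obj C"
  shows "i \<in> Arr C"
proof -
  have "i \<in> embeddings D F" "i \<in> Arr D" "Cod D i = X"
    using assms by (auto simp: embeddings_def embedding_of_def)
  then show ?thesis
    using embeddings_closed assms by (simp add: Arr_iff)
qed

text \<open>A conormal cluster is the image of its embedding, whose domain lies in the subcategory.\<close>

lemma conormal_sub:
  assumes "X \<in> Obj C"
  shows "conormal C F X S \<longleftrightarrow> conormal D F X S"
proof
  assume "conormal C F X S"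
  then show "conormal D F X S"
    using Arr_subset by (auto simp: conormal_def Im_sub Cod_eq)
next
  assume "conormal D F X S"
  then obtain f where f: "f \<in> Hom D (Dom D f) X" "Im D F f = S"
    by (auto simp: conormal_def Hom_def)
  then obtain m where m: "embedding_of D F X S m"
    using form.form_factorization by blast
  then show "conormal C F X S"
    using embedding_of_arr_sub[OF m assms]
    by (auto simp: conormal_def embedding_of_def Im_sub Cod_eq)
qed

text \<open>The test arrows in \<open>C\<close> are among those in \<open>D\<close>, and the induced
  factors lie in \<open>C\<close> because closure puts the domain of \<open>i\<close> there.\<close>

lemma embedding_of_sub:
  assumes i: "embedding_of D F X S i" and X: "X \<in> Obj C"
  shows "embedding_of C F X S i"
proof -
  have iC: "i \<in> Arr C"
    using assms by (rule embedding_of_arr_sub)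
  then have iH: "i \<in> Hom C (Dom D i) (Cod D i)" and iO: "Dom D i \<in> Obj C"
    by (auto simp: Hom_def Dom_eq Cod_eq Arr_iff)
  show ?thesis
    unfolding embedding_of_def
  proof (intro conjI ballI impI)
    fix f
    assume f: "f \<in> Arr C" and "Cod C f = X \<and> Im C F f \<sqsubseteq>\<^bsub>fibre F X\<^esub> S"
    then have "f \<in> Arr D" "Cod D f = X" "Im D F f \<sqsubseteq>\<^bsub>fibre F X\<^esub> S"
      using Arr_subset by (auto simp: Im_sub Cod_eq)
    then have "\<exists>!h. h \<in> Hom D (Dom D f) (Dom D i) \<and> f = i \<cdot>\<^bsub>D\<^esub> h"
      using i unfolding embedding_of_def by blast
    moreover have "Dom D f \<in> Obj C"
      using f by (simp add: Arr_iff)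
    ultimately show "\<exists>!h. h \<in> Hom C (Dom C f) (Dom C i) \<and> f = i \<cdot>\<^bsub>C\<^esub> h"
      using Hom_eq[OF _ iO] Comp_eq[OF _ iH] f iC by (metis (no_types, lifting) Dom_eq)
  qed (use i X iC conormal_sub in \<open>auto simp: embedding_of_def Im_sub Cod_eq\<close>)
qed

text \<open>
  An embedding \<open>i\<close> in the subcategory and an ambient embedding \<open>m\<close> of the same cluster factor
  through each other, so \<open>i\<close> inherits the universal property of \<open>m\<close> in the ambient category.
\<close>

lemma embedding_of_ambient:
  assumes i: "embedding_of C F X S i"
  shows "embedding_of D F X S i"
proof -
  have iC: "i \<in> Arr C" "Cod C i = X" "Im C F i = S" and con: "conormal C F X S"
    using i by (auto simp: embedding_of_def)
  then have X: "X \<in> Obj C"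
    using sub.Cod_Obj by blast
  let ?I = "Dom D i"
  have iH: "i \<in> Hom C ?I X" and Im_i: "Im D F i = S"
    using iC by (auto simp: Hom_def Dom_eq Im_sub)
  then have iD: "i \<in> Hom D ?I X"
    using Hom_subset by blast
  interpret X: bounded_lattice "fibre F X"
    using X Obj_subset form.fibre_lattice by blast
  obtain m where mS: "embedding_of D F X S m"
    using form.form_factorization[OF iD] Im_i by blast
  let ?M = "Dom D m"
  have m: "m \<in> embeddings D F" "m \<in> Hom D ?M X" "Im D F m = S" "m \<in> Arr C"
    using mS embedding_of_arr_sub[OF mS X] by (auto simp: embeddings_def embedding_of_def Hom_def)
  have O: "?I \<in> Obj C" "?M \<in> Obj C"
    using iC m(4) by (auto simp: Arr_iff)
  have S: "S \<sqsubseteq>\<^bsub>fibre F X\<^esub> S"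
    using form.Im_closed[OF iD] Im_i by auto
  have mono_m: "mono_arr D m"
    using form.embeddings_mono m by blast
  obtain k where k: "k \<in> Hom D ?I ?M" "i = m \<cdot>\<^bsub>D\<^esub> k"
    using form.embeddings_factor[OF m(1,2) iD] S m(3) Im_i by metis
  have ex1: "\<exists>!h. h \<in> Hom C (Dom C f) (Dom C i) \<and> f = i \<cdot>\<^bsub>C\<^esub> h"
    if "f \<in> Arr C" "Cod C f = X" "Im D F f \<sqsubseteq>\<^bsub>fibre F X\<^esub> S" for f
    using i that by (auto simp: embedding_of_def Im_sub)
  \<comment> \<open>Closure under embeddings makes \<open>m\<close> an arrow of \<open>C\<close>,
    hence a test arrow for \<open>i\<close>; its factor \<open>l\<close> is the comparison in the
    direction opposite to \<open>k\<close>.\<close>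
  have "\<exists>!h. h \<in> Hom C ?M ?I \<and> m = i \<cdot>\<^bsub>C\<^esub> h"
    using ex1[of m] m S iC by (auto simp: Dom_eq Cod_eq Hom_def)
  then obtain l where lC: "l \<in> Hom C ?M ?I" and "m = i \<cdot>\<^bsub>C\<^esub> l"
    by blast
  then have l: "l \<in> Hom D ?M ?I" "m = i \<cdot>\<^bsub>D\<^esub> l"
    using Hom_subset Comp_eq[OF lC iH] by auto
  have lk: "l \<cdot>\<^bsub>D\<^esub> k \<in> Hom C ?I ?I"
    using ambient.Comp_Hom[OF k(1) l(1)] O by (simp add: Hom_eq)
  have "i \<cdot>\<^bsub>D\<^esub> (l \<cdot>\<^bsub>D\<^esub> k) = i"
    using ambient.Comp_assoc[OF k(1) l(1) iD] by (simp flip: l(2) k(2))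
  then have "i = i \<cdot>\<^bsub>C\<^esub> (l \<cdot>\<^bsub>D\<^esub> k)"
    using Comp_eq[OF lk iH] by simp
  moreover have "Id D ?I \<in> Hom C ?I ?I" "i = i \<cdot>\<^bsub>C\<^esub> Id D ?I"
    using O(1) sub.Id_Hom sub.Comp_Id[OF iH] by (simp_all add: Id_eq[symmetric])
  \<comment> \<open>\<open>i\<close> is not yet known to be monic in \<open>D\<close>, so it is not
    cancelled; uniqueness of the factor of \<open>i\<close> through itself in \<open>C\<close> is
    used instead.\<close>
  moreover have "\<exists>!h. h \<in> Hom C ?I ?I \<and> i = i \<cdot>\<^bsub>C\<^esub> h"
    using ex1[of i] iC S Im_i by (simp add: Dom_eq)
  ultimately have lk_id: "l \<cdot>\<^bsub>D\<^esub> k = Id D ?I"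
    using lk by blast
  show ?thesis
    unfolding embedding_of_def
  proof (intro conjI ballI impI)
    show "conormal D F X S"
      using con X by (simp add: conormal_sub)
    show "i \<in> Arr D" "Cod D i = X" "Im D F i = S"
      using iD Im_i by (auto simp: Hom_def)
    fix f
    assume f: "f \<in> Arr D" "Cod D f = X \<and> Im D F f \<sqsubseteq>\<^bsub>fibre F X\<^esub> S"
    then have fH: "f \<in> Hom D (Dom D f) X"
      by (simp add: Hom_def)
    obtain h where h: "h \<in> Hom D (Dom D f) ?M" "f = m \<cdot>\<^bsub>D\<^esub> h"
      using form.embeddings_factor[OF m(1,2) fH] f m(3) by metis
    have "l \<cdot>\<^bsub>D\<^esub> h \<in> Hom D (Dom D f) ?I \<and> f = i \<cdot>\<^bsub>D\<^esub> (l \<cdot>\<^bsub>D\<^esub> h)"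
      using ambient.Comp_Hom[OF h(1) l(1)] ambient.Comp_assoc[OF h(1) l(1) iD] h(2) l(2) by simp
    \<comment> \<open>Cancelling the monic \<open>m\<close> gives \<open>k \<cdot> g = h\<close>,
      and \<open>l\<close> undoes \<open>k\<close>.\<close>
    moreover have "g = l \<cdot>\<^bsub>D\<^esub> h" if g: "g \<in> Hom D (Dom D f) ?I" "f = i \<cdot>\<^bsub>D\<^esub> g" for g
    proof -
      have "m \<cdot>\<^bsub>D\<^esub> (k \<cdot>\<^bsub>D\<^esub> g) = m \<cdot>\<^bsub>D\<^esub> h"
        using g(2) h(2) k(2) ambient.Comp_assoc[OF g(1) k(1) m(2)] by simp
      then have "k \<cdot>\<^bsub>D\<^esub> g = h"
        by (rule ambient.mono_arrD[OF mono_m m(2) ambient.Comp_Hom[OF g(1) k(1)] h(1)])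
      then show ?thesis
        using ambient.Comp_assoc[OF g(1) k(1) l(1)] lk_id ambient.Id_Comp[OF g(1)] by simp
    qed
    ultimately show "\<exists>!h. h \<in> Hom D (Dom D f) ?I \<and> f = i \<cdot>\<^bsub>D\<^esub> h"
      by blast
  qed
qed

lemma embeddings_sub: "embeddings C F = embeddings D F \<inter> Arr C"
proof
  show "embeddings C F \<subseteq> embeddings D F \<inter> Arr C"
  proof
    fix i
    assume "i \<in> embeddings C F"
    then obtain X S where "embedding_of C F X S i"
      by (auto simp: embeddings_def)
    moreover from this have "i \<in> Arr C"
      by (simp add: embedding_of_def)
    ultimately show "i \<in> embeddings D F \<inter> Arr C"
      using embedding_of_ambient unfolding embeddings_def by blast
  qed
  show "embeddings D F \<inter> Arr C \<subseteq> embeddings C F"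
  proof
    fix i
    assume "i \<in> embeddings D F \<inter> Arr C"
    then obtain S where "embedding_of D F (Cod D i) S i" "Cod D i \<in> Obj C"
      by (auto simp: embeddings_def embedding_of_def Arr_iff)
    then show "i \<in> embeddings C F"
      using embedding_of_sub unfolding embeddings_def by blast
  qed
qed

lemma quotients_sub: "quotients C F = quotients D F \<inter> Arr C"
proof -
  interpret op: closed_subcategory "op_cat C" "op_cat D" "op_form F"
    by (rule closed_subcategory_op)
  show ?thesis
    using op.embeddings_sub by simp
qed

text \<open>(N1) is inherited because \<open>C\<close> and \<open>D\<close> compute the same images
  and kernels for arrows of \<open>C\<close>; (N2) because the ambient factors are arrows of
  \<open>C\<close> with the same universal properties there; (N3) because the two categories have
  the same normal and conormal clusters over objects of \<open>C\<close>.\<close>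

lemma noetherian_form_sub: "noetherian_form C F"
proof -
  interpret op: closed_subcategory "op_cat C" "op_cat D" "op_form F"
    by (rule closed_subcategory_op)
  have orean: "orean_form C F"
  proof (intro orean_form.intro orean_form_axioms.intro sub.category_axioms)
    show "bounded_lattice (fibre F X)" if "X \<in> Obj C" for X
      using that Obj_subset form.fibre_lattice by blast
    show "galois_connection
        \<lparr>orderA = fibre F X, orderB = fibre F Y, lower = push F f, upper = pull F f\<rparr>"
      if "f \<in> Hom C X Y" for f X Y
      using that Hom_subset form.transport by blast
    show "push F (g \<cdot>\<^bsub>C\<^esub> f) S = push F g (push F f S)"
      if "f \<in> Hom C X Y" "g \<in> Hom C Y Z" "S \<in> carrier (fibre F X)" for f g X Y Z S
      using form.push_Comp[OF subsetD[OF Hom_subset that(1)] subsetD[OF Hom_subset that(2)] that(3)]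
        Comp_eq[OF that(1,2)] by simp
    show "pull F (g \<cdot>\<^bsub>C\<^esub> f) U = pull F f (pull F g U)"
      if "f \<in> Hom C X Y" "g \<in> Hom C Y Z" "U \<in> carrier (fibre F Z)" for f g X Y Z U
      using form.pull_Comp[OF subsetD[OF Hom_subset that(1)] subsetD[OF Hom_subset that(2)] that(3)]
        Comp_eq[OF that(1,2)] by simp
    show "push F (Id C X) S = S" "pull F (Id C X) S = S"
      if "X \<in> Obj C" "S \<in> carrier (fibre F X)" for X S
      using that Obj_subset form.push_Id form.pull_Id by (auto simp: Id_eq)
  qed
  show ?thesis
  proof (intro noetherian_form.intro noetherian_form_axioms.intro orean)
    show "pull F f (push F f S) = S \<squnion>\<^bsub>fibre F X\<^esub> Ker C F f"
      if "f \<in> Hom C X Y" "S \<in> carrier (fibre F X)" for f X Y S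
    proof -
      have "f \<in> Hom D X Y" "f \<in> Arr C"
        using that Hom_subset by (auto simp: Hom_def)
      then show ?thesis
        using that form.pull_push by (simp add: Ker_sub)
    qed
    show "push F f (pull F f U) = U \<sqinter>\<^bsub>fibre F Y\<^esub> Im C F f"
      if "f \<in> Hom C X Y" "U \<in> carrier (fibre F Y)" for f X Y U
    proof -
      have "f \<in> Hom D X Y" "f \<in> Arr C"
        using that Hom_subset by (auto simp: Hom_def)
      then show ?thesis
        using that form.push_pull by (simp add: Im_sub)
    qed
    show "\<exists>e m. quotient_of C F X (Ker C F f) e \<and> embedding_of C F Y (Im C F f) m \<and>
        Dom C m = Cod C e \<and> f = m \<cdot>\<^bsub>C\<^esub> e" if f: "f \<in> Hom C X Y" for f X Y
    proof -
      have fD: "f \<in> Hom D X Y" "f \<in> Arr C" and O: "X \<in> Obj C" "Y \<in> Obj C"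
        using f Hom_subset Hom_ObjD by (auto simp: Hom_def)
      obtain e m where e: "quotient_of D F X (Ker D F f) e" and m: "embedding_of D F Y (Im D F f) m"
        and eq: "Dom D m = Cod D e" "f = m \<cdot>\<^bsub>D\<^esub> e"
        using form.form_factorization[OF fD(1)] by blast
      have "quotient_of C F X (Ker D F f) e" "embedding_of C F Y (Im D F f) m"
        using op.embedding_of_sub[of X _ e] e O embedding_of_sub[OF m] by auto
      moreover from this have "e \<in> Arr C" "m \<in> Arr C"
        by (auto simp: quotient_of_def embedding_of_def)
      moreover from this have "m \<cdot>\<^bsub>C\<^esub> e = m \<cdot>\<^bsub>D\<^esub> e"
        using Comp_eq[of e "Dom D e" "Cod D e" m "Cod D m"] eq by (simp add: Hom_def Dom_eq Cod_eq)
      ultimately show ?thesis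
        using eq fD by (intro exI[of _ e] exI[of _ m]) (simp add: Im_sub Ker_sub Dom_eq Cod_eq)
    qed
    show "normal C F X (K \<squnion>\<^bsub>fibre F X\<^esub> L)"
      if "X \<in> Obj C" "normal C F X K" "normal C F X L" for X K L
      using that op.conormal_sub[of X] form.normal_join Obj_subset by auto
    show "conormal C F X (S \<sqinter>\<^bsub>fibre F X\<^esub> R)"
      if "X \<in> Obj C" "conormal C F X S" "conormal C F X R" for X S R
      using that conormal_sub[of X] form.conormal_meet Obj_subset by auto
  qed
qed

text \<open>Closure is applied to the diagonal \<open>m \<cdot> p\<close>, an embedding into an
  object of \<open>C\<close> whose domain is the apex.\<close>

lemma ambient_pullback:
  assumes "m \<in> embeddings D F" "n \<in> embeddings D F" "m \<in> Arr C" "n \<in> Arr C" "Cod D m = Cod D n"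
  obtains p q where "is_pullback D m n p q" "Dom D p \<in> Obj C"
proof -
  have m: "m \<in> Hom D (Dom D m) (Cod D n)" and n: "n \<in> Hom D (Dom D n) (Cod D n)"
    using assms Arr_subset by (auto simp: Hom_def)
  obtain p q where pb: "is_pullback D m n p q" and emb: "m \<cdot>\<^bsub>D\<^esub> p \<in> embeddings D F"
    using form.embeddings_pullback[OF assms(1) m assms(2) n] by metis
  have "p \<in> Hom D (Dom D p) (Dom D m)"
    using pb by (simp add: is_pullback_def)
  then have "m \<cdot>\<^bsub>D\<^esub> p \<in> Hom D (Dom D p) (Cod D n)"
    using m ambient.Comp_Hom by blast
  moreover have "Cod D n \<in> Obj C"
    using assms by (simp add: Arr_iff)
  ultimately have "Dom D p \<in> Obj C"
    using embeddings_closed[OF emb] by (simp add: Hom_def)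
  then show thesis
    using that pb by blast
qed

lemma has_pullbacks_sub: "has_pullbacks_of C (embeddings D F \<inter> Arr C)"
  unfolding has_pullbacks_of_def
proof (intro ballI impI)
  fix m n
  assume "m \<in> embeddings D F \<inter> Arr C" "n \<in> embeddings D F \<inter> Arr C" "Cod C m = Cod C n"
  then show "\<exists>p q. is_pullback C m n p q"
    using ambient_pullback[of m n] is_pullback_sub by (metis Cod_eq IntD1 IntD2)
qed

text \<open>The square given in \<open>C\<close> need not be the one constructed from a meet, so it
  is compared with an ambient pullback whose apex lies in \<open>C\<close>.\<close>

lemma preserves_pullbacks_sub:
  assumes "m \<in> embeddings D F" "n \<in> embeddings D F" "is_pullback C m n p q"
  shows "is_pullback D m n p q"
proof -
  have "m \<in> Arr C" "n \<in> Arr C" "Cod D m = Cod D n"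
    using assms(3) by (auto simp: is_pullback_def Cod_eq)
  then obtain p' q' where "is_pullback D m n p' q'" "Dom D p' \<in> Obj C"
    using ambient_pullback assms by metis
  then show ?thesis
    using is_pullback_ambient assms(3) by blast
qed

lemma induced_factorization_system_sub:
  "proper_factorization_system C (quotients D F \<inter> Arr C) (embeddings D F \<inter> Arr C)"
  using factorization_system_sub[OF form.induced_factorization_system] embeddings_closed by blast

text \<open>The pushout clauses are the pullback clauses for the opposite categories, where left and
  right classes are exchanged.\<close>

lemma transfer_functor_inclusion:
  "transfer_functor C (quotients D F \<inter> Arr C) (embeddings D F \<inter> Arr C)
    D (quotients D F) (embeddings D F) inclusion"
proof -
  interpret op: closed_subcategory "op_cat C" "op_cat D" "op_form F"
    by (rule closed_subcategory_op)
  show ?thesis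
  proof (intro transfer_functor.intro transfer_functor_axioms.intro cat_functor_inclusion
      induced_factorization_system_sub form.induced_factorization_system
      form.embeddings_has_pullbacks has_pullbacks_sub)
    show "has_pushouts_of C (quotients D F \<inter> Arr C)"
      using op.has_pullbacks_sub by simp
    show "has_pushouts_of D (quotients D F)"
      using op.form.embeddings_has_pullbacks by simp
    show "iso_arr C f" if "f \<in> Arr C" "iso_arr D (on_Arr inclusion f)" for f
      using that by (simp add: inclusion_def iso_arr_sub)
    show "is_pullback D (on_Arr inclusion m) (on_Arr inclusion n)
        (on_Arr inclusion p) (on_Arr inclusion q)"
      if "m \<in> embeddings D F \<inter> Arr C" "n \<in> embeddings D F \<inter> Arr C" "is_pullback C m n p q" for m n p q
      using that preserves_pullbacks_sub by (simp add: inclusion_def)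
    show "is_pushout D (on_Arr inclusion d) (on_Arr inclusion e)
        (on_Arr inclusion p) (on_Arr inclusion q)"
      if "d \<in> quotients D F \<inter> Arr C" "e \<in> quotients D F \<inter> Arr C" "is_pushout C d e p q" for d e p q
      using that op.preserves_pullbacks_sub[of d e p q] by (simp add: inclusion_def)
  qed (auto simp: inclusion_def)
qed

end

text \<open>Fibres and transports are total functions on the underlying types, so restricting a form
  leaves the record as it is; only the category it is paired with changes.\<close>

lemma pullback_form_inclusion [simp]: "pullback_form inclusion F = F"
  by (simp add: pullback_form_def inclusion_def)

theorem proposition3p30:
  fixes C D :: "('o, 'a) category"
    and F :: "('o, 'a, 'c) form"
    and E M :: "'a set"
  assumes "noetherian_form D F"
    and "induces_system D F E M"
    and "full_replete_subcategory C D"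
    and "\<And>m A X. \<lbrakk>m \<in> Hom D A X; m \<in> M; X \<in> Obj C\<rbrakk> \<Longrightarrow> A \<in> Obj C"
    and "\<And>e X B. \<lbrakk>e \<in> Hom D X B; e \<in> E; X \<in> Obj C\<rbrakk> \<Longrightarrow> B \<in> Obj C"
  shows "proper_factorization_system C (E \<inter> Arr C) (M \<inter> Arr C) \<and>
         transfer_functor C (E \<inter> Arr C) (M \<inter> Arr C) D E M inclusion \<and>
         noetherian_form C (pullback_form inclusion F) \<and>
         induces_system C (pullback_form inclusion F) (E \<inter> Arr C) (M \<inter> Arr C) \<and>
         (complete_fibres D F \<longrightarrow> complete_fibres C (pullback_form inclusion F)) \<and>
         (algebraic_fibres D F \<longrightarrow> algebraic_fibres C (pullback_form inclusion F)) \<and>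
         (modular_fibres D F \<longrightarrow> modular_fibres C (pullback_form inclusion F))"
proof -
  interpret F: noetherian_form D F
    by fact
  interpret full_subcategory C D
    using assms(3) by (rule full_replete_subcategory.full_subcategory)
  have E: "E = quotients D F" and M: "M = embeddings D F"
    using assms(2) by (auto simp: induces_system_def)
  interpret closed_subcategory C D F
  proof
    show "Dom D m \<in> Obj C" if "m \<in> embeddings D F" "Cod D m \<in> Obj C" for m
      using that assms(4)[of m "Dom D m" "Cod D m"] M F.embeddings_iff by (simp add: Hom_def)
    show "Cod D e \<in> Obj C" if "e \<in> quotients D F" "Dom D e \<in> Obj C" for e
    proof -
      have "e \<in> Arr D"
        using that by (auto simp: quotients_def quotient_of_def)
      then show ?thesis
        using that assms(5)[of e "Dom D e" "Cod D e"] E by (simp add: Hom_def)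
    qed
  qed
  \<comment> \<open>Completeness, algebraicity and modularity concern single fibres, and the objects
    of \<open>C\<close> are among those of \<open>D\<close>.\<close>
  show ?thesis
    unfolding E M
    using induced_factorization_system_sub transfer_functor_inclusion noetherian_form_sub Obj_subset
    by (auto simp: induces_system_def quotients_sub embeddings_sub complete_fibres_def
        algebraic_fibres_def modular_fibres_def)
qed

end
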